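(* Let $R$ be an algebraic curvature tensor on an $n$-dimensional Euclidean vector space $(V,g)$ and let $\omega$ be a $p$-form on $V$, $p\ge 1$. With respect to any orthonormal basis, the curvature term in the Bochner formula satisfies $$\frac32\,g(\mathrm{Ric}_L(\omega),\omega)=g(\mathcal{R}(\omega^{S_0^2}),\omega^{S_0^2})+\frac{p(n-2p)}{n}\sum_{j,k}\sum_{i_2,\dots,i_p}R_{jk}\,\omega_{ji_2\dots i_p}\omega_{ki_2\dots i_p}+\frac{p^2}{n^2}\,\mathrm{scal}\,|\omega|^2.$$ If the orthonormal basis diagonalizes the Ricci tensor, then furthermore $$\frac32\,g(\mathrm{Ric}_L(\omega),\omega)=g(\mathcal{R}(\omega^{S_0^2}),\omega^{S_0^2})+\frac{n-2p}{n}\sum_{I=(i_1,\dots,i_p)}\Big(\sum_{i\in I}R_{ii}\Big)\omega_I^2+\frac{p^2}{n^2}\,\mathrm{scal}\,|\omega|^2.$$ In particular, if $R$ is Einstein, i.e. $\mathrm{Ric}=\frac{\mathrm{scal}}{n}g$, then $$\frac32\,g(\mathrm{Ric}_L(\omega),\omega)=g(\mathcal{R}(\omega^{S_0^2}),\omega^{S_0^2})+\frac{p(n-p)}{n^2}\,\mathrm{scal}\,|\omega|^2.$$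
   Context: Components are with respect to an orthonormal basis $e_1,\dots,e_n$ of $V$. An algebraic curvature tensor is a $(0,4)$-tensor with the symmetries of a Riemannian curvature tensor (including the first Bianchi identity). Sign convention: the unit round sphere has $R_{ijkl}=\delta_{ik}\delta_{jl}-\delta_{il}\delta_{jk}$; the Ricci tensor is $R_{ij}=\sum_kR_{ikjk}$ and $\mathrm{scal}=\sum_iR_{ii}$. $S^2(V)$ (resp. $S^2_0(V)$) is the space of symmetric (resp. trace-free symmetric) $(0,2)$-tensors, identified via $g$ with (trace-free) self-adjoint endomorphisms. $\overline{R}\colon S^2(V)\to S^2(V)$, $(\overline{R}(h))_{ij}=\sum_{k,l}R_{iklj}h_{kl}$, and $\mathcal{R}=\mathrm{pr}_{S_0^2(V)}\circ\overline{R}|_{S_0^2(V)}$ is the curvature operator of the second kind. For $S\in S^2(V)$ and a $p$-form $\omega$, $(S\omega)(X_1,\dots,X_p)=\sum_{i=1}^p\omega(X_1,\dots,SX_i,\dots,X_p)$. For an orthonormal basis $\{S_\alpha\}$ of $S_0^2(V)$, set $\omega^{S_0^2}=\sum_\alpha S_\alpha\omega\otimes S_\alpha$ and $\mathcal{R}(\omega^{S_0^2})=\sum_\alpha S_\alpha\omega\otimes\mathcal{R}(S_\alpha)$, so $g(\mathcal{R}(\omega^{S_0^2}),\omega^{S_0^2})=\sum_{\alpha,\beta}g(S_\alpha\omega,S_\beta\omega)\,g(\mathcal{R}(S_\alpha),S_\beta)$. Forms carry the tensor norm $|\omega|^2=\sum_{i_1,\dots,i_p}\omega_{i_1\dots i_p}^2$;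 sums over multi-indices $I=(i_1,\dots,i_p)$ run over $\{1,\dots,n\}^p$. $\mathrm{Ric}_L$ is the curvature term in the Weitzenböck formula $\Delta_{\mathrm{Hodge}}=\nabla^*\nabla+\mathrm{Ric}_L$ on $p$-forms; explicitly $$g(\mathrm{Ric}_L(\omega),\omega)=p\sum_{i_2,\dots,i_p}\sum_{i,j}R_{ij}\omega_{ii_2\dots i_p}\omega_{ji_2\dots i_p}-\frac{p(p-1)}{2}\sum_{i_3,\dots,i_p}\sum_{i,j,k,l}R_{ijkl}\omega_{iji_3\dots i_p}\omega_{kli_3\dots i_p}$$ (the second term being $0$ for $p=1$). *)

theory Defs
  imports "HOL-Analysis.Analysis"
begin

text \<open>
  The Euclidean vector space $(V,g)$ is a type of class \<^class>\<open>euclidean_space\<close> with its inner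
  product, of dimension \<open>DIM('a)\<close>. Orthonormal bases are indexed by \<open>{..<DIM('a)}\<close>.
\<close>

definition orthonormal_basis :: "(nat \<Rightarrow> 'a::euclidean_space) \<Rightarrow> bool" where
  "orthonormal_basis e \<longleftrightarrow>
     (\<forall>i<DIM('a). \<forall>j<DIM('a). e i \<bullet> e j = (if i = j then 1 else 0)) \<and>
     span (e ` {..<DIM('a)}) = UNIV"

definition algebraic_curvature_tensor ::
    "('a::euclidean_space \<Rightarrow> 'a \<Rightarrow> 'a \<Rightarrow> 'a \<Rightarrow> real) \<Rightarrow> bool" where
  "algebraic_curvature_tensor R \<longleftrightarrow>
     (\<forall>y z w. linear (\<lambda>x. R x y z w)) \<and> (\<forall>x z w. linear (\<lambda>y. R x y z w)) \<and>
     (\<forall>x y w. linear (\<lambda>z. R x y z w)) \<and> (\<forall>x y z. linear (\<lambda>w. R x y z w)) \<and>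
     (\<forall>x y z w. R y x z w = - R x y z w) \<and>
     (\<forall>x y z w. R x y w z = - R x y z w) \<and>
     (\<forall>x y z w. R z w x y = R x y z w) \<and>
     (\<forall>x y z w. R x y z w + R y z x w + R z x y w = 0)"

text \<open>
  Sign convention: the unit round sphere has
  \<open>R x y z w = (x \<bullet> z) * (y \<bullet> w) - (x \<bullet> w) * (y \<bullet> z)\<close>.
\<close>

definition Ric :: "('a::euclidean_space \<Rightarrow> 'a \<Rightarrow> 'a \<Rightarrow> 'a \<Rightarrow> real) \<Rightarrow> (nat \<Rightarrow> 'a) \<Rightarrow> 'a \<Rightarrow> 'a \<Rightarrow> real" where
  "Ric R e x y = (\<Sum>k<DIM('a). R x (e k) y (e k))"

definition scal :: "('a::euclidean_space \<Rightarrow> 'a \<Rightarrow> 'a \<Rightarrow> 'a \<Rightarrow> real) \<Rightarrow> (nat \<Rightarrow> 'a) \<Rightarrow> real" where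
  "scal R e = (\<Sum>i<DIM('a). Ric R e (e i) (e i))"


subsection \<open>Symmetric tensors and the curvature operator of the second kind\<close>

definition sym2 :: "('a::euclidean_space \<Rightarrow> 'a \<Rightarrow> real) set" where
  "sym2 = {h. bilinear h \<and> (\<forall>x y. h x y = h y x)}"

definition tr2 :: "(nat \<Rightarrow> 'a::euclidean_space) \<Rightarrow> ('a \<Rightarrow> 'a \<Rightarrow> real) \<Rightarrow> real" where
  "tr2 e h = (\<Sum>i<DIM('a). h (e i) (e i))"

definition sym2_0 :: "(nat \<Rightarrow> 'a::euclidean_space) \<Rightarrow> ('a \<Rightarrow> 'a \<Rightarrow> real) set" where
  "sym2_0 e = {h \<in> sym2. tr2 e h = 0}"

definition inner2 ::
    "(nat \<Rightarrow> 'a::euclidean_space) \<Rightarrow> ('a \<Rightarrow> 'a \<Rightarrow> real) \<Rightarrow> ('a \<Rightarrow> 'a \<Rightarrow> real) \<Rightarrow> real" where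
  "inner2 e h k = (\<Sum>i<DIM('a). \<Sum>j<DIM('a). h (e i) (e j) * k (e i) (e j))"

definition sharp2 :: "(nat \<Rightarrow> 'a::euclidean_space) \<Rightarrow> ('a \<Rightarrow> 'a \<Rightarrow> real) \<Rightarrow> 'a \<Rightarrow> 'a" where
  "sharp2 e h x = (\<Sum>i<DIM('a). h x (e i) *\<^sub>R e i)"

text \<open>
  The orthogonal projection of symmetric tensors onto the trace-free ones; that it is this
  projection is lemma \<open>pr0_is_orthogonal_projection\<close>.
\<close>

definition pr0 ::
    "(nat \<Rightarrow> 'a::euclidean_space) \<Rightarrow> ('a \<Rightarrow> 'a \<Rightarrow> real) \<Rightarrow> 'a \<Rightarrow> 'a \<Rightarrow> real" where
  "pr0 e h x y = h x y - tr2 e h / real DIM('a) * (x \<bullet> y)"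

definition R_bar :: "('a::euclidean_space \<Rightarrow> 'a \<Rightarrow> 'a \<Rightarrow> 'a \<Rightarrow> real) \<Rightarrow> (nat \<Rightarrow> 'a) \<Rightarrow>
    ('a \<Rightarrow> 'a \<Rightarrow> real) \<Rightarrow> 'a \<Rightarrow> 'a \<Rightarrow> real" where
  "R_bar R e h x y = (\<Sum>k<DIM('a). \<Sum>l<DIM('a). R x (e k) (e l) y * h (e k) (e l))"

text \<open>Only the values on \<^const>\<open>sym2_0\<close> are meaningful.\<close>

definition R_second :: "('a::euclidean_space \<Rightarrow> 'a \<Rightarrow> 'a \<Rightarrow> 'a \<Rightarrow> real) \<Rightarrow> (nat \<Rightarrow> 'a) \<Rightarrow>
    ('a \<Rightarrow> 'a \<Rightarrow> real) \<Rightarrow> 'a \<Rightarrow> 'a \<Rightarrow> real" where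
  "R_second R e h = pr0 e (R_bar R e h)"

definition orthonormal_basis_sym2_0 :: "(nat \<Rightarrow> 'a::euclidean_space) \<Rightarrow> 'i set \<Rightarrow>
    ('i \<Rightarrow> 'a \<Rightarrow> 'a \<Rightarrow> real) \<Rightarrow> bool" where
  "orthonormal_basis_sym2_0 e A S \<longleftrightarrow>
     finite A \<and> (\<forall>\<alpha>\<in>A. S \<alpha> \<in> sym2_0 e) \<and>
     (\<forall>\<alpha>\<in>A. \<forall>\<beta>\<in>A. inner2 e (S \<alpha>) (S \<beta>) = (if \<alpha> = \<beta> then 1 else 0)) \<and>
     (\<forall>h\<in>sym2_0 e. \<exists>c. \<forall>x y. h x y = (\<Sum>\<alpha>\<in>A. c \<alpha> * S \<alpha> x y))"


subsection \<open>Forms\<close>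

text \<open>
  A \<open>p\<close>-form is evaluated at the list \<open>[x\<^sub>1, \<dots>, x\<^sub>p]\<close> of its arguments; its values at lists of
  other lengths are irrelevant.
\<close>

definition p_form :: "nat \<Rightarrow> ('a::euclidean_space list \<Rightarrow> real) \<Rightarrow> bool" where
  "p_form p \<omega> \<longleftrightarrow>
     (\<forall>xs i. length xs = p \<and> i < p \<longrightarrow> linear (\<lambda>v. \<omega> (xs[i := v]))) \<and>
     (\<forall>xs i j. length xs = p \<and> i < j \<and> j < p \<and> xs ! i = xs ! j \<longrightarrow> \<omega> xs = 0)"

definition multi_indices :: "nat \<Rightarrow> nat \<Rightarrow> nat list set" where
  "multi_indices n p = {I. length I = p \<and> set I \<subseteq> {..<n}}"

definition inner_form :: "(nat \<Rightarrow> 'a::euclidean_space) \<Rightarrow> nat \<Rightarrow>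
    ('a list \<Rightarrow> real) \<Rightarrow> ('a list \<Rightarrow> real) \<Rightarrow> real" where
  "inner_form e p \<omega> \<eta> = (\<Sum>I\<in>multi_indices DIM('a) p. \<omega> (map e I) * \<eta> (map e I))"

definition sym_act :: "(nat \<Rightarrow> 'a::euclidean_space) \<Rightarrow> ('a \<Rightarrow> 'a \<Rightarrow> real) \<Rightarrow>
    ('a list \<Rightarrow> real) \<Rightarrow> 'a list \<Rightarrow> real" where
  "sym_act e S \<omega> xs = (\<Sum>i<length xs. \<omega> (xs[i := sharp2 e S (xs ! i)]))"

text \<open>
  Elements of $\Lambda^p V^* \otimes S^2(V)$ are functions of a list (the arguments of the form)
  and of two further vectors (the arguments of the symmetric tensor).
\<close>

definition form_sym :: "(nat \<Rightarrow> 'a::euclidean_space) \<Rightarrow> 'i set \<Rightarrow> ('i \<Rightarrow> 'a \<Rightarrow> 'a \<Rightarrow> real) \<Rightarrow>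
    ('a list \<Rightarrow> real) \<Rightarrow> 'a list \<Rightarrow> 'a \<Rightarrow> 'a \<Rightarrow> real" where
  "form_sym e A S \<omega> = (\<lambda>xs x y. \<Sum>\<alpha>\<in>A. sym_act e (S \<alpha>) \<omega> xs * S \<alpha> x y)"

definition R_form_sym :: "('a::euclidean_space \<Rightarrow> 'a \<Rightarrow> 'a \<Rightarrow> 'a \<Rightarrow> real) \<Rightarrow> (nat \<Rightarrow> 'a) \<Rightarrow> 'i set \<Rightarrow>
    ('i \<Rightarrow> 'a \<Rightarrow> 'a \<Rightarrow> real) \<Rightarrow> ('a list \<Rightarrow> real) \<Rightarrow> 'a list \<Rightarrow> 'a \<Rightarrow> 'a \<Rightarrow> real" where
  "R_form_sym R e A S \<omega> = (\<lambda>xs x y. \<Sum>\<alpha>\<in>A. sym_act e (S \<alpha>) \<omega> xs * R_second R e (S \<alpha>) x y)"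

definition inner_form_sym :: "(nat \<Rightarrow> 'a::euclidean_space) \<Rightarrow> nat \<Rightarrow>
    ('a list \<Rightarrow> 'a \<Rightarrow> 'a \<Rightarrow> real) \<Rightarrow> ('a list \<Rightarrow> 'a \<Rightarrow> 'a \<Rightarrow> real) \<Rightarrow> real" where
  "inner_form_sym e p T U = (\<Sum>I\<in>multi_indices DIM('a) p. inner2 e (T (map e I)) (U (map e I)))"


subsection \<open>The curvature term of the Weitzenboeck formula\<close>

text \<open>
  The curvature endomorphism $R(x,y)z$. In the sign convention above
  $g(R(x,y)z, w) = R(x,y,w,z)$, so that $R(x,y)z = g(y,z)x - g(x,z)y$ on the unit round sphere.
\<close>

definition curv_endo :: "('a::euclidean_space \<Rightarrow> 'a \<Rightarrow> 'a \<Rightarrow> 'a \<Rightarrow> real) \<Rightarrow> (nat \<Rightarrow> 'a) \<Rightarrow>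
    'a \<Rightarrow> 'a \<Rightarrow> 'a \<Rightarrow> 'a" where
  "curv_endo R e x y z = (\<Sum>k<DIM('a). R x y (e k) z *\<^sub>R e k)"

definition curv_act :: "('a::euclidean_space \<Rightarrow> 'a \<Rightarrow> 'a \<Rightarrow> 'a \<Rightarrow> real) \<Rightarrow> (nat \<Rightarrow> 'a) \<Rightarrow>
    'a \<Rightarrow> 'a \<Rightarrow> ('a list \<Rightarrow> real) \<Rightarrow> 'a list \<Rightarrow> real" where
  "curv_act R e x y \<omega> zs = - (\<Sum>m<length zs. \<omega> (zs[m := curv_endo R e x y (zs ! m)]))"

text \<open>
  $\mathrm{Ric}_L(\omega)(x_1,\dots,x_p)
    = \sum_i \sum_a (R(e_a, x_i)\omega)(x_1,\dots,e_a,\dots,x_p)$ with $e_a$ in position $i$;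
  the quadratic form is computed in components in lemma \<open>inner_form_Ric_L\<close>.
\<close>

definition Ric_L :: "('a::euclidean_space \<Rightarrow> 'a \<Rightarrow> 'a \<Rightarrow> 'a \<Rightarrow> real) \<Rightarrow> (nat \<Rightarrow> 'a) \<Rightarrow>
    ('a list \<Rightarrow> real) \<Rightarrow> 'a list \<Rightarrow> real" where
  "Ric_L R e \<omega> xs =
     (\<Sum>i<length xs. \<Sum>a<DIM('a). curv_act R e (e a) (xs ! i) \<omega> (xs[i := e a]))"


subsection \<open>Agreement with the component formulas\<close>

lemma tr2_inner:
  fixes e :: "nat \<Rightarrow> 'a::euclidean_space"
  assumes "orthonormal_basis e"
  shows "tr2 e (\<bullet>) = real DIM('a)"
  using assms by (simp add: tr2_def orthonormal_basis_def)

lemma pr0_is_orthogonal_projection: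
  fixes e :: "nat \<Rightarrow> 'a::euclidean_space"
  assumes e: "orthonormal_basis e" and h: "h \<in> sym2"
  shows "pr0 e h \<in> sym2_0 e"
    and "k \<in> sym2_0 e \<Longrightarrow> inner2 e (\<lambda>x y. h x y - pr0 e h x y) k = 0"
proof -
  have lin: "linear (\<lambda>x. h x y)" "linear (h x)" for x y
    using h by (auto simp: sym2_def bilinear_def)
  have "linear (\<lambda>y. pr0 e h x y)" "linear (\<lambda>x. pr0 e h x y)" for x y
    unfolding linear_iff pr0_def
    by (simp_all add: linear_add[OF lin(1)] linear_add[OF lin(2)] linear_cmul[OF lin(1)]
        linear_cmul[OF lin(2)] inner_simps algebra_simps add_divide_distrib)
  moreover have "pr0 e h x y = pr0 e h y x" for x y
    using h by (simp add: pr0_def sym2_def inner_commute)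
  ultimately have "pr0 e h \<in> sym2"
    by (simp add: sym2_def bilinear_def)
  moreover have "tr2 e (pr0 e h) = 0"
  proof -
    have "tr2 e (pr0 e h) = tr2 e h - tr2 e h / real DIM('a) * tr2 e (\<bullet>)"
      by (simp only: tr2_def pr0_def sum_subtractf sum_distrib_left)
    then show ?thesis by (simp add: tr2_inner[OF e])
  qed
  ultimately show "pr0 e h \<in> sym2_0 e"
    by (simp add: sym2_0_def)
  assume k: "k \<in> sym2_0 e"
  have "inner2 e (\<lambda>x y. h x y - pr0 e h x y) k =
      (\<Sum>i<DIM('a). \<Sum>j<DIM('a). if i = j then tr2 e h / real DIM('a) * k (e i) (e j) else 0)"
    unfolding inner2_def pr0_def using e
    by (intro sum.cong refl) (simp add: orthonormal_basis_def)
  also have "\<dots> = tr2 e h / real DIM('a) * tr2 e k"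
    by (simp add: tr2_def sum_distrib_left)
  finally show "inner2 e (\<lambda>x y. h x y - pr0 e h x y) k = 0"
    using k by (simp add: sym2_0_def)
qed

lemma inner2_sum:
  "inner2 e (\<lambda>x y. \<Sum>\<alpha>\<in>A. c \<alpha> * S \<alpha> x y) (\<lambda>x y. \<Sum>\<beta>\<in>B. d \<beta> * T \<beta> x y) =
   (\<Sum>\<alpha>\<in>A. \<Sum>\<beta>\<in>B. c \<alpha> * d \<beta> * inner2 e (S \<alpha>) (T \<beta>))"
proof -
  have "inner2 e (\<lambda>x y. \<Sum>\<alpha>\<in>A. c \<alpha> * S \<alpha> x y) (\<lambda>x y. \<Sum>\<beta>\<in>B. d \<beta> * T \<beta> x y) =
    (\<Sum>i<DIM('a). \<Sum>j<DIM('a). \<Sum>\<alpha>\<in>A. \<Sum>\<beta>\<in>B.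
       c \<alpha> * d \<beta> * (S \<alpha> (e i) (e j) * T \<beta> (e i) (e j)))"
    unfolding inner2_def sum_product by (simp add: mult_ac)
  also have "\<dots> = (\<Sum>\<alpha>\<in>A. \<Sum>\<beta>\<in>B. \<Sum>i<DIM('a). \<Sum>j<DIM('a).
       c \<alpha> * d \<beta> * (S \<alpha> (e i) (e j) * T \<beta> (e i) (e j)))"
    by (simp only: sum.swap[where A="{..<DIM('a)}" and B=A]
          sum.swap[where A="{..<DIM('a)}" and B=B])
  finally show ?thesis
    by (simp add: inner2_def sum_distrib_left)
qed

lemma inner_form_sym_components:
  "inner_form_sym e p (R_form_sym R e A S \<omega>) (form_sym e A S \<omega>) =
   (\<Sum>\<alpha>\<in>A. \<Sum>\<beta>\<in>A. inner_form e p (sym_act e (S \<alpha>) \<omega>) (sym_act e (S \<beta>) \<omega>) *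
      inner2 e (R_second R e (S \<alpha>)) (S \<beta>))"
  unfolding inner_form_sym_def R_form_sym_def form_sym_def inner2_sum inner_form_def
  by (subst sum.swap, intro sum.cong refl, subst sum.swap) (simp add: sum_distrib_right)


lemma finite_multi_indices [simp]: "finite (multi_indices n p)"
  using finite_lists_length_eq[of "{..<n}" p] by (simp add: multi_indices_def conj_commute)

lemma sum_multi_indices_Suc:
  "(\<Sum>I\<in>multi_indices n (Suc p). f I) = (\<Sum>i<n. \<Sum>J\<in>multi_indices n p. f (i # J))"
proof -
  have "(\<Sum>I\<in>multi_indices n (Suc p). f I) =
      (\<Sum>(i, J)\<in>{..<n} \<times> multi_indices n p. f (i # J))"
    by (rule sum.reindex_bij_witness[where i="\<lambda>(i, J). i # J" and j="\<lambda>I. (hd I, tl I)"])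
       (auto simp: multi_indices_def length_Suc_conv)
  then show ?thesis
    by (simp add: sum.cartesian_product)
qed

definition swap_list :: "nat \<Rightarrow> nat \<Rightarrow> 'b list \<Rightarrow> 'b list" where
  "swap_list s t xs = xs[s := xs ! t, t := xs ! s]"

lemma length_swap_list [simp]: "length (swap_list s t xs) = length xs"
  by (simp add: swap_list_def)

lemma nth_swap_list:
  "s < length xs \<Longrightarrow> t < length xs \<Longrightarrow> k < length xs \<Longrightarrow>
   swap_list s t xs ! k = xs ! Transposition.transpose s t k"
  by (auto simp: swap_list_def nth_list_update Transposition.transpose_def)

lemma transpose_less: "s < p \<Longrightarrow> t < p \<Longrightarrow> k < p \<Longrightarrow> Transposition.transpose s t k < (p::nat)"
  by (auto simp: Transposition.transpose_def)

lemma swap_list_swap_list: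
  "s < length xs \<Longrightarrow> t < length xs \<Longrightarrow> swap_list s t (swap_list s t xs) = xs"
  by (rule nth_equalityI) (auto simp: nth_swap_list transpose_less)

lemma set_swap_list: "s < length xs \<Longrightarrow> t < length xs \<Longrightarrow> set (swap_list s t xs) = set xs"
  by (simp add: swap_list_def)

lemma swap_list_update:
  "s < length xs \<Longrightarrow> t < length xs \<Longrightarrow> i < length xs \<Longrightarrow>
   (swap_list s t xs)[i := a] = swap_list s t (xs[Transposition.transpose s t i := a])"
  by (rule nth_equalityI)
     (auto simp: nth_swap_list nth_list_update transpose_less, (metis transpose_involutory)+)

lemma map_swap_list:
  "s < length xs \<Longrightarrow> t < length xs \<Longrightarrow> map f (swap_list s t xs) = swap_list s t (map f xs)"
  by (simp add: swap_list_def map_update)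

lemma p_form_swap:
  assumes w: "p_form p \<omega>" and len: "length xs = p" "s < p" "t < p" "s \<noteq> t"
  shows "\<omega> (swap_list s t xs) = - \<omega> xs"
proof -
  define F where "F u v = \<omega> (xs[s := u, t := v])" for u v
  have l2: "linear (F u)" for u
    using w len unfolding p_form_def F_def by (metis length_list_update)
  have l1: "linear (\<lambda>u. F u v)" for v
  proof -
    have "linear (\<lambda>u. \<omega> (xs[t := v, s := u]))"
      using w len unfolding p_form_def by (metis length_list_update)
    then show ?thesis
      using len by (simp add: F_def list_update_swap)
  qed
  have F0: "F u u = 0" for u
  proof -
    have "xs[s := u, t := u] ! s = xs[s := u, t := u] ! t"
      using len by simp
    then show ?thesis
      using w len unfolding p_form_def F_def by (metis length_list_update linorder_neqE_nat)
  qed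
  have "0 = F (u + v) (u + v)" for u v by (simp add: F0)
  then have "F v u = - F u v" for u v
    using linear_add[OF l1] linear_add[OF l2] F0 by (smt (verit))
  then have "F (xs ! t) (xs ! s) = - F (xs ! s) (xs ! t)" .
  then show ?thesis
    using len by (simp add: F_def swap_list_def)
qed

lemma sum_multi_indices_swap:
  assumes "s < p" "t < p"
  shows "(\<Sum>I\<in>multi_indices n p. f I) = (\<Sum>I\<in>multi_indices n p. f (swap_list s t I))"
  by (rule sum.reindex_bij_witness[where i="swap_list s t" and j="swap_list s t"])
     (use assms in \<open>auto simp: multi_indices_def set_swap_list swap_list_swap_list\<close>)

lemma sum_pair_swap:
  assumes w: "p_form p \<omega>" and st: "s < p" "t < p" and im: "i < p" "m < p"
  defines "\<tau> \<equiv> Transposition.transpose s t"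
  shows "(\<Sum>I\<in>multi_indices n p. c (I ! i) (I ! m) * \<omega> (map e (I[i := a, m := b])) * \<omega> (map e I)) =
    (\<Sum>I\<in>multi_indices n p. c (I ! \<tau> i) (I ! \<tau> m) * \<omega> (map e (I[\<tau> i := a, \<tau> m := b])) * \<omega> (map e I))"
proof (cases "s = t")
  case True
  then show ?thesis by (simp add: \<tau>_def)
next
  case False
  have "c (swap_list s t I ! i) (swap_list s t I ! m) *
      \<omega> (map e ((swap_list s t I)[i := a, m := b])) * \<omega> (map e (swap_list s t I)) =
      c (I ! \<tau> i) (I ! \<tau> m) * \<omega> (map e (I[\<tau> i := a, \<tau> m := b])) * \<omega> (map e I)"
    if I: "I \<in> multi_indices n p" for I
  proof -
    have l: "length I = p" using I by (simp add: multi_indices_def)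
    have "map e ((swap_list s t I)[i := a, m := b]) = swap_list s t (map e (I[\<tau> i := a, \<tau> m := b]))"
      using l st im by (simp add: swap_list_update map_swap_list \<tau>_def transpose_less)
    then have 1: "\<omega> (map e ((swap_list s t I)[i := a, m := b])) = - \<omega> (map e (I[\<tau> i := a, \<tau> m := b]))"
      using p_form_swap[OF w] l st False by (metis length_list_update length_map)
    have 2: "\<omega> (map e (swap_list s t I)) = - \<omega> (map e I)"
      using p_form_swap[OF w, of "map e I" s t] l st False by (simp add: map_swap_list)
    show ?thesis
      unfolding 1 2 using l st im by (simp add: nth_swap_list \<tau>_def)
  qed
  then show ?thesis
    by (subst sum_multi_indices_swap[OF st]) (rule sum.cong, auto)
qed

lemma sum_single_first:
  assumes w: "p_form p \<omega>" and i: "i < p"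
  shows "(\<Sum>I\<in>multi_indices n p. c (I ! i) * \<omega> (map e (I[i := a])) * \<omega> (map e I)) =
    (\<Sum>k<n. \<Sum>J\<in>multi_indices n (p - 1). c k * \<omega> (map e (a # J)) * \<omega> (map e (k # J)))"
proof -
  have "(\<Sum>I\<in>multi_indices n p. c (I ! i) * \<omega> (map e (I[i := a])) * \<omega> (map e I)) =
      (\<Sum>I\<in>multi_indices n p. c (I ! 0) * \<omega> (map e (I[0 := a])) * \<omega> (map e I))"
    using sum_pair_swap[OF w, where s=0 and t=i and i=i and m=i and n=n and c="\<lambda>x y. c x" and e=e and a=a and b=a] i
    by (simp add: Transposition.transpose_def)
  also have "\<dots> = (\<Sum>I\<in>multi_indices n (Suc (p - 1)). c (I ! 0) * \<omega> (map e (I[0 := a])) * \<omega> (map e I))"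
    using i by simp
  finally show ?thesis
    unfolding sum_multi_indices_Suc by simp
qed

lemma sum_pair_first:
  assumes w: "p_form p \<omega>" and im: "i < p" "m < p" "i \<noteq> m"
  shows "(\<Sum>I\<in>multi_indices n p. c (I ! i) (I ! m) * \<omega> (map e (I[i := a, m := b])) * \<omega> (map e I)) =
    (\<Sum>k<n. \<Sum>l<n. \<Sum>J\<in>multi_indices n (p - 2).
       c k l * \<omega> (map e (a # b # J)) * \<omega> (map e (k # l # J)))"
proof -
  define G where "G i m =
    (\<Sum>I\<in>multi_indices n p. c (I ! i) (I ! m) * \<omega> (map e (I[i := a, m := b])) * \<omega> (map e I))" for i m
  have G: "G i m = G (Transposition.transpose s t i) (Transposition.transpose s t m)"
    if "s < p" "t < p" "i < p" "m < p" for s t i m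
    unfolding G_def by (rule sum_pair_swap[OF w that])
  define m' where "m' = Transposition.transpose 0 i m"
  have m': "m' < p" "m' \<noteq> 0" "p = Suc (Suc (p - 2))"
    using im by (auto simp: m'_def Transposition.transpose_def)
  have "G i m = G 0 m'"
    using G[of 0 i i m] im by (simp add: m'_def)
  also have "\<dots> = G 0 1"
    using G[of 1 m' 0 m'] m' im by (auto simp: Transposition.transpose_def)
  also have "\<dots> = (\<Sum>I\<in>multi_indices n (Suc (Suc (p - 2))).
      c (I ! 0) (I ! 1) * \<omega> (map e (I[0 := a, 1 := b])) * \<omega> (map e I))"
    using m'(3) by (simp add: G_def)
  finally show ?thesis
    unfolding sum_multi_indices_Suc by (simp add: G_def)
qed

lemma p_form_update_sum:
  assumes w: "p_form p \<omega>" and "length xs = p" "i < p"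
  shows "\<omega> (xs[i := (\<Sum>k<n. c k *\<^sub>R e k)]) = (\<Sum>k<(n::nat). c k * \<omega> (xs[i := e k]))"
proof -
  have "linear (\<lambda>v. \<omega> (xs[i := v]))"
    using assms unfolding p_form_def by blast
  then show ?thesis
    by (simp add: linear_sum[OF \<open>linear _\<close>] linear_cmul[OF \<open>linear _\<close>])
qed

lemma inner_form_Ric_L:
  fixes R :: "'a::euclidean_space \<Rightarrow> 'a \<Rightarrow> 'a \<Rightarrow> 'a \<Rightarrow> real" and e :: "nat \<Rightarrow> 'a"
  defines "n \<equiv> DIM('a)"
  assumes R: "algebraic_curvature_tensor R" and w: "p_form p \<omega>" and p: "p \<ge> 1"
  shows "inner_form e p (Ric_L R e \<omega>) \<omega> =
    real p * (\<Sum>J\<in>multi_indices n (p - 1). \<Sum>i<n. \<Sum>j<n.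
        Ric R e (e i) (e j) * \<omega> (e i # map e J) * \<omega> (e j # map e J))
    - real p * (real p - 1) / 2 * (\<Sum>J\<in>multi_indices n (p - 2). \<Sum>i<n. \<Sum>j<n. \<Sum>k<n. \<Sum>l<n.
        R (e i) (e j) (e k) (e l) * \<omega> (e i # e j # map e J) * \<omega> (e k # e l # map e J))"
proof -
  define w1 where "w1 a J = \<omega> (e a # map e J)" for a J
  define w2 where "w2 a b J = \<omega> (e a # e b # map e J)" for a b J
  define r where "r i j k l = R (e i) (e j) (e k) (e l)" for i j k l
  define M where "M = multi_indices n"
  have R1: "r j i k l = - r i j k l" "r i j l k = - r i j k l" "r k l i j = r i j k l"
    "r i j k l + r j k i l + r k i j l = 0" for i j k l
    using R unfolding algebraic_curvature_tensor_def r_def by blast+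
  define P where "P = (\<Sum>a<n. \<Sum>b<n. \<Sum>k<n. \<Sum>J\<in>M (p - 1). r a k b a * w1 b J * w1 k J)"
  define Q where "Q = (\<Sum>a<n. \<Sum>b<n. \<Sum>k<n. \<Sum>l<n. \<Sum>J\<in>M (p - 2).
      r a k b l * w2 a b J * w2 k l J)"
  define T where "T I i m a b = (if m = i then r a (I ! i) b a * \<omega> (map e (I[i := b]))
      else r a (I ! i) b (I ! m) * \<omega> (map e (I[i := a, m := b])))" for I i m a b

  have act: "curv_act R e (e a) (map e I ! i) \<omega> ((map e I)[i := e a]) = - (\<Sum>m<p. \<Sum>b<n. T I i m a b)"
    if I: "I \<in> M p" and i: "i < p" for I i a
  proof -
    have l: "length I = p" using I by (simp add: M_def multi_indices_def)
    have "\<omega> ((map e I)[i := e a, m := curv_endo R e (e a) (map e I ! i) ((map e I)[i := e a] ! m)])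
        = (\<Sum>b<n. T I i m a b)" if m: "m < p" for m
      unfolding curv_endo_def
      using l m i by (subst p_form_update_sum[OF w])
        (auto simp: T_def n_def r_def map_update intro!: sum.cong)
    then show ?thesis
      using l by (simp add: curv_act_def)
  qed

  have diag: "(\<Sum>I\<in>M p. \<Sum>a<n. \<Sum>b<n. T I i i a b * \<omega> (map e I)) = P" if i: "i < p" for i
  proof -
    have "(\<Sum>I\<in>M p. \<Sum>a<n. \<Sum>b<n. T I i i a b * \<omega> (map e I)) =
        (\<Sum>a<n. \<Sum>b<n. \<Sum>I\<in>M p. T I i i a b * \<omega> (map e I))"
      by (subst sum.swap, intro sum.cong refl, subst sum.swap) simp
    also have "\<dots> = P"
      unfolding P_def T_def M_def
      by (intro sum.cong refl)
         (use sum_single_first[OF w i, where n=n and e=e] in \<open>simp add: w1_def\<close>)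
    finally show ?thesis .
  qed

  have offdiag: "(\<Sum>I\<in>M p. \<Sum>a<n. \<Sum>b<n. T I i m a b * \<omega> (map e I)) = Q"
    if im: "i < p" "m < p" "i \<noteq> m" for i m
  proof -
    have "(\<Sum>I\<in>M p. \<Sum>a<n. \<Sum>b<n. T I i m a b * \<omega> (map e I)) =
        (\<Sum>a<n. \<Sum>b<n. \<Sum>I\<in>M p. T I i m a b * \<omega> (map e I))"
      by (subst sum.swap, intro sum.cong refl, subst sum.swap) simp
    also have "\<dots> = Q"
      unfolding Q_def M_def
    proof (intro sum.cong refl)
      fix a b
      show "(\<Sum>I\<in>multi_indices n p. T I i m a b * \<omega> (map e I)) =
        (\<Sum>k<n. \<Sum>l<n. \<Sum>J\<in>multi_indices n (p - 2). r a k b l * w2 a b J * w2 k l J)"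
        using sum_pair_first[OF w im, where n=n and e=e and a=a and b=b and c="\<lambda>k l. r a k b l"] im
        by (simp add: w2_def T_def)
    qed
    finally show ?thesis .
  qed

  have "inner_form e p (Ric_L R e \<omega>) \<omega> =
      (\<Sum>I\<in>M p. (\<Sum>i<p. \<Sum>a<n. - (\<Sum>m<p. \<Sum>b<n. T I i m a b)) * \<omega> (map e I))"
  proof -
    have "Ric_L R e \<omega> (map e I) = (\<Sum>i<p. \<Sum>a<n. - (\<Sum>m<p. \<Sum>b<n. T I i m a b))"
      if I: "I \<in> M p" for I
    proof -
      have l: "length (map e I) = p" using I by (simp add: M_def multi_indices_def)
      show ?thesis
        unfolding Ric_L_def l n_def[symmetric] by (intro sum.cong refl) (auto simp: act[OF I])
    qed
    then show ?thesis
      unfolding inner_form_def M_def[symmetric] n_def[symmetric] by simp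
  qed
  also have "\<dots> = - (\<Sum>I\<in>M p. \<Sum>i<p. \<Sum>a<n. \<Sum>m<p. \<Sum>b<n. T I i m a b * \<omega> (map e I))"
    by (simp add: sum_distrib_right sum_negf)
  also have "(\<Sum>I\<in>M p. \<Sum>i<p. \<Sum>a<n. \<Sum>m<p. \<Sum>b<n. T I i m a b * \<omega> (map e I)) =
      (\<Sum>i<p. \<Sum>m<p. \<Sum>I\<in>M p. \<Sum>a<n. \<Sum>b<n. T I i m a b * \<omega> (map e I))"
  proof -
    have "(\<Sum>I\<in>M p. \<Sum>i<p. \<Sum>a<n. \<Sum>m<p. \<Sum>b<n. T I i m a b * \<omega> (map e I)) =
        (\<Sum>i<p. \<Sum>I\<in>M p. \<Sum>a<n. \<Sum>m<p. \<Sum>b<n. T I i m a b * \<omega> (map e I))"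
      by (rule sum.swap)
    also have "\<dots> = (\<Sum>i<p. \<Sum>I\<in>M p. \<Sum>m<p. \<Sum>a<n. \<Sum>b<n. T I i m a b * \<omega> (map e I))"
      by (rule sum.cong[OF refl], rule sum.cong[OF refl], rule sum.swap)
    also have "\<dots> = (\<Sum>i<p. \<Sum>m<p. \<Sum>I\<in>M p. \<Sum>a<n. \<Sum>b<n. T I i m a b * \<omega> (map e I))"
      by (intro sum.cong refl) (rule sum.swap)
    finally show ?thesis .
  qed
  also have "\<dots> = (\<Sum>i<p. \<Sum>m<p. if m = i then P else Q)"
    using diag offdiag by (intro sum.cong refl) auto
  also have "\<dots> = (\<Sum>i<p. P + (real p - 1) * Q)"
  proof (intro sum.cong refl)
    fix i assume i: "i \<in> {..<p}"
    have "(\<Sum>m<p. if m = i then P else Q) = (\<Sum>m<p. (if m = i then P - Q else 0) + Q)"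
      by (intro sum.cong) auto
    also have "\<dots> = P + (real p - 1) * Q"
      using i by (simp add: sum.distrib algebra_simps)
    finally show "(\<Sum>m<p. if m = i then P else Q) = P + (real p - 1) * Q" .
  qed
  finally have main: "inner_form e p (Ric_L R e \<omega>) \<omega> = - (real p * P) - real p * (real p - 1) * Q"
    by (simp add: algebra_simps)

  have P: "- P = (\<Sum>J\<in>M (p - 1). \<Sum>i<n. \<Sum>j<n. Ric R e (e i) (e j) * w1 i J * w1 j J)"
  proof -
    have "P = (\<Sum>a<n. \<Sum>b<n. \<Sum>J\<in>M (p - 1). \<Sum>k<n. r a k b a * w1 b J * w1 k J)"
      unfolding P_def by (intro sum.cong refl) (rule sum.swap)
    also have "\<dots> = (\<Sum>a<n. \<Sum>J\<in>M (p - 1). \<Sum>b<n. \<Sum>k<n. r a k b a * w1 b J * w1 k J)"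
      by (intro sum.cong refl) (rule sum.swap)
    also have "\<dots> = (\<Sum>J\<in>M (p - 1). \<Sum>a<n. \<Sum>b<n. \<Sum>k<n. r a k b a * w1 b J * w1 k J)"
      by (rule sum.swap)
    also have "\<dots> = (\<Sum>J\<in>M (p - 1). \<Sum>b<n. \<Sum>a<n. \<Sum>k<n. r a k b a * w1 b J * w1 k J)"
      by (rule sum.cong[OF refl], rule sum.swap)
    also have "\<dots> = (\<Sum>J\<in>M (p - 1). \<Sum>b<n. \<Sum>k<n. \<Sum>a<n. r a k b a * w1 b J * w1 k J)"
      by (rule sum.cong[OF refl], rule sum.cong[OF refl], rule sum.swap)
    also have "\<dots> = (\<Sum>J\<in>M (p - 1). \<Sum>b<n. \<Sum>k<n. - (Ric R e (e b) (e k) * w1 b J * w1 k J))"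
    proof (intro sum.cong refl)
      fix J b k
      have "(\<Sum>a<n. r a k b a) = - (\<Sum>a<n. r b a k a)"
        using R1 by (metis (no_types, lifting) sum.cong sum_negf)
      then show "(\<Sum>a<n. r a k b a * w1 b J * w1 k J) = - (Ric R e (e b) (e k) * w1 b J * w1 k J)"
        by (simp add: Ric_def n_def r_def flip: sum_distrib_right)
    qed
    finally show ?thesis by (simp add: sum_negf)
  qed

  have Q: "2 * Q = (\<Sum>J\<in>M (p - 2). \<Sum>i<n. \<Sum>j<n. \<Sum>k<n. \<Sum>l<n. r i j k l * w2 i j J * w2 k l J)"
    if p2: "p \<ge> 2"
  proof -
    have anti: "w2 b a J = - w2 a b J" if "J \<in> M (p - 2)" for a b J
      using p_form_swap[OF w, of "e a # e b # map e J" 0 1] p2 that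
      by (simp add: w2_def swap_list_def M_def multi_indices_def)
    have bianchi: "r a k b l - r b k a l = r a b k l" for a b k l
      using R1(1)[of b k a l] R1(1)[of b a k l] R1(4)[of a k b l] R1(1)[of a b k l]
        R1(1)[of k b a l] by linarith
    have "Q = (\<Sum>b<n. \<Sum>a<n. \<Sum>k<n. \<Sum>l<n. \<Sum>J\<in>M (p - 2). r a k b l * w2 a b J * w2 k l J)"
      unfolding Q_def by (rule sum.swap)
    also have "\<dots> = (\<Sum>a<n. \<Sum>b<n. \<Sum>k<n. \<Sum>l<n. \<Sum>J\<in>M (p - 2). - (r b k a l * w2 a b J * w2 k l J))"
      by (intro sum.cong refl) (metis anti mult_minus_left mult_minus_right)
    finally have "2 * Q = (\<Sum>a<n. \<Sum>b<n. \<Sum>k<n. \<Sum>l<n. \<Sum>J\<in>M (p - 2).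
        r a k b l * w2 a b J * w2 k l J + - (r b k a l * w2 a b J * w2 k l J))"
      unfolding sum.distrib by (simp add: Q_def)
    also have "\<dots> = (\<Sum>a<n. \<Sum>b<n. \<Sum>k<n. \<Sum>l<n. \<Sum>J\<in>M (p - 2). r a b k l * w2 a b J * w2 k l J)"
    proof (intro sum.cong refl)
      fix a b k l J
      show "r a k b l * w2 a b J * w2 k l J + - (r b k a l * w2 a b J * w2 k l J) =
          r a b k l * w2 a b J * w2 k l J"
        by (simp only: bianchi[where a=a and b=b and k=k and l=l, symmetric]) (simp add: algebra_simps)
    qed
    also have "\<dots> = (\<Sum>J\<in>M (p - 2). \<Sum>a<n. \<Sum>b<n. \<Sum>k<n. \<Sum>l<n. r a b k l * w2 a b J * w2 k l J)"
      by (simp only: sum.swap[where A="{..<n}" and B="M (p - 2)"])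
    finally show ?thesis .
  qed
  have "real p * (real p - 1) * Q = real p * (real p - 1) / 2 *
      (\<Sum>J\<in>M (p - 2). \<Sum>i<n. \<Sum>j<n. \<Sum>k<n. \<Sum>l<n. r i j k l * w2 i j J * w2 k l J)"
  proof (cases "p \<ge> 2")
    case True
    show ?thesis unfolding Q[OF True, symmetric] by simp
  next
    case False
    then have "p = 1" using p by simp
    then show ?thesis by simp
  qed
  with main have "inner_form e p (Ric_L R e \<omega>) \<omega> = real p * (- P) - real p * (real p - 1) / 2 *
      (\<Sum>J\<in>M (p - 2). \<Sum>i<n. \<Sum>j<n. \<Sum>k<n. \<Sum>l<n. r i j k l * w2 i j J * w2 k l J)"
    by simp
  then show ?thesis
    unfolding P unfolding M_def w1_def w2_def r_def .
qed

end

theory Submission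
  imports Defs
begin

text \<open>
  Put $U_I(k,l) = \sum_m \delta_{i_m k}\, \omega_{i_1 \dots l \dots i_p}$ with $l$ in position $m$.
  Since the $S_\alpha$ form an orthonormal basis, the $I$-component of $\omega^{S_0^2}$ is the
  trace-free symmetric part of $U_I$, i.e. $\mathrm{sym}(U_I) - \frac{p}{n}\omega_I g$. Expanding
  the quadratic form of $\overline{R}$ at it, the metric part produces the multiples of Ricci and
  scalar curvature with coefficients in $p^2/n$ and $p^2/n^2$. In
  $\sum_I U_I(k,l)\, U_I(i,j)$ the two substitutions happen either in the same slot, which yields a
  Ricci contraction, or in different slots, which yields full curvature contractions; by the first
  Bianchi identity both of the latter are multiples of
  $\sum R_{ijkl}\, \omega_{ij\dots}\, \omega_{kl\dots}$, with total factor $-\frac32$.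
\<close>

section \<open>Orthonormal bases of trace-free symmetric tensors\<close>

text \<open>Pairing any expansion of \<open>h\<close> with one basis element isolates its
  coefficient, so the coefficients are the inner products.\<close>

lemma orthonormal_basis_sym2_0_expansion:
  assumes S: "orthonormal_basis_sym2_0 e A S" and h: "h \<in> sym2_0 e"
  shows "h x y = (\<Sum>\<alpha>\<in>A. inner2 e h (S \<alpha>) * S \<alpha> x y)"
proof -
  have A: "finite A"
    and ortho: "\<And>\<alpha> \<beta>. \<alpha> \<in> A \<Longrightarrow> \<beta> \<in> A \<Longrightarrow> inner2 e (S \<alpha>) (S \<beta>) = (if \<alpha> = \<beta> then 1 else 0)"
    using S by (simp_all add: orthonormal_basis_sym2_0_def)
  obtain c where c: "\<And>x y. h x y = (\<Sum>\<alpha>\<in>A. c \<alpha> * S \<alpha> x y)"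
    using S h unfolding orthonormal_basis_sym2_0_def by meson
  have "inner2 e h (S \<beta>) = c \<beta>" if \<beta>: "\<beta> \<in> A" for \<beta>
  proof -
    \<comment> \<open>The basis element is written as a one-term combination so that the bilinear
      expansion \<open>inner2_sum\<close> applies.\<close>
    have "inner2 e h (S \<beta>) =
        inner2 e (\<lambda>x y. \<Sum>\<alpha>\<in>A. c \<alpha> * S \<alpha> x y) (\<lambda>x y. \<Sum>\<gamma>\<in>{\<beta>}. 1 * S \<gamma> x y)"
      by (simp add: inner2_def c)
    also have "\<dots> = (\<Sum>\<alpha>\<in>A. if \<alpha> = \<beta> then c \<alpha> else 0)"
      unfolding inner2_sum using \<beta> by (intro sum.cong) (auto simp: ortho)
    finally show ?thesis
      using A \<beta> by simp
  qed
  then show ?thesis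
    by (simp add: c)
qed

text \<open>This is the orthogonal projection of an arbitrary matrix \<open>u\<close> onto the
  trace-free symmetric ones: the antisymmetric part of \<open>u\<close> is orthogonal to the
  symmetric \<open>S \<alpha>\<close>, and its trace part to the trace-free ones.\<close>

lemma sum_orthonormal_basis_sym2_0:
  fixes e :: "nat \<Rightarrow> 'a::euclidean_space" and u :: "nat \<Rightarrow> nat \<Rightarrow> real"
  defines "n \<equiv> DIM('a)"
  assumes e: "orthonormal_basis e" and S: "orthonormal_basis_sym2_0 e A S"
    and ij: "i < n" "j < n"
  shows "(\<Sum>\<alpha>\<in>A. (\<Sum>k<n. \<Sum>l<n. u k l * S \<alpha> (e k) (e l)) * S \<alpha> (e i) (e j)) =
    (u i j + u j i) / 2 - (if i = j then (\<Sum>k<n. u k k) / real n else 0)"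
proof -
  have on: "e i \<bullet> e j = (if i = j then 1 else 0)" if "i < n" "j < n" for i j
    using e that by (simp add: orthonormal_basis_def n_def)
  \<comment> \<open>The symmetric tensor whose components are the symmetric part of
    \<open>u\<close>; its trace-free part is what gets expanded in the basis.\<close>
  define v where "v x y = (\<Sum>k<n. \<Sum>l<n. (u k l + u l k) / 2 * (x \<bullet> e k) * (y \<bullet> e l))" for x y
  have v_comm: "v x y = v y x" for x y
    unfolding v_def by (subst sum.swap, intro sum.cong refl) (simp add: add.commute mult_ac)
  have "linear (v x)" for x
    by (rule linearI)
      (simp_all add: v_def inner_simps algebra_simps sum.distrib sum_distrib_left add_divide_distrib)
  moreover have "(\<lambda>x. v x y) = v y" for y
    by (rule ext) (rule v_comm)
  ultimately have v: "v \<in> sym2"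
    using v_comm by (simp add: sym2_def bilinear_def)
  have ve: "v (e i) (e j) = (u i j + u j i) / 2" if "i < n" "j < n" for i j
  proof -
    have "v (e i) (e j) =
        (\<Sum>k<n. \<Sum>l<n. if k = i then (if l = j then (u k l + u l k) / 2 else 0) else 0)"
      unfolding v_def using that by (intro sum.cong) (auto simp: on)
    also have "\<dots> = (\<Sum>k<n. if k = i then (u k j + u j k) / 2 else 0)"
      using that by (intro sum.cong) auto
    finally show ?thesis
      using that by simp
  qed
  have coeff: "inner2 e (pr0 e v) (S \<alpha>) = (\<Sum>k<n. \<Sum>l<n. u k l * S \<alpha> (e k) (e l))"
    if \<alpha>: "\<alpha> \<in> A" for \<alpha>
  proof -
    have S0: "S \<alpha> \<in> sym2_0 e"
      using S \<alpha> by (simp add: orthonormal_basis_sym2_0_def)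
    then have Ssym: "S \<alpha> x y = S \<alpha> y x" for x y
      by (simp add: sym2_0_def sym2_def)
    have "inner2 e (pr0 e v) (S \<alpha>) = inner2 e v (S \<alpha>)"
      using pr0_is_orthogonal_projection(2)[OF e v S0]
      by (simp add: inner2_def sum_subtractf left_diff_distrib)
    also have "\<dots> = (\<Sum>k<n. \<Sum>l<n. u k l * S \<alpha> (e k) (e l)) / 2
        + (\<Sum>k<n. \<Sum>l<n. u l k * S \<alpha> (e k) (e l)) / 2"
      unfolding inner2_def n_def[symmetric]
      by (simp add: ve add_divide_distrib distrib_right sum.distrib flip: sum_divide_distrib)
    also have "(\<Sum>k<n. \<Sum>l<n. u l k * S \<alpha> (e k) (e l)) = (\<Sum>k<n. \<Sum>l<n. u k l * S \<alpha> (e k) (e l))"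
      by (subst sum.swap, intro sum.cong refl) (simp add: Ssym)
    finally show ?thesis by simp
  qed
  have "(\<Sum>\<alpha>\<in>A. (\<Sum>k<n. \<Sum>l<n. u k l * S \<alpha> (e k) (e l)) * S \<alpha> (e i) (e j)) = pr0 e v (e i) (e j)"
    using orthonormal_basis_sym2_0_expansion[OF S pr0_is_orthogonal_projection(1)[OF e v]]
    by (simp add: coeff)
  also have "\<dots> = (u i j + u j i) / 2 - (if i = j then (\<Sum>k<n. u k k) / real n else 0)"
    using ij by (simp add: pr0_def tr2_def ve on flip: n_def)
  finally show ?thesis .
qed

text \<open>Each projection \<open>pr0\<close> only subtracts a multiple of the metric, which is
  orthogonal to the trace-free \<open>T\<close>. Hence the curvature operator of the second kind has
  the quadratic form of \<open>R_bar\<close>, and linearity of \<open>R_bar\<close> moves the sum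
  inside.\<close>

lemma inner2_R_second_sum:
  fixes e :: "nat \<Rightarrow> 'a::euclidean_space" and c :: "'i \<Rightarrow> real"
  defines "n \<equiv> DIM('a)"
  assumes e: "orthonormal_basis e" and S: "\<And>\<alpha>. \<alpha> \<in> A \<Longrightarrow> S \<alpha> \<in> sym2_0 e"
  defines "T \<equiv> \<lambda>x y. \<Sum>\<alpha>\<in>A. c \<alpha> * S \<alpha> x y"
  shows "inner2 e (\<lambda>x y. \<Sum>\<alpha>\<in>A. c \<alpha> * R_second R e (S \<alpha>) x y) T =
    (\<Sum>i<n. \<Sum>j<n. \<Sum>k<n. \<Sum>l<n. R (e i) (e k) (e l) (e j) * T (e k) (e l) * T (e i) (e j))"
proof -
  have on: "e i \<bullet> e j = (if i = j then 1 else 0)" if "i < n" "j < n" for i j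
    using e that by (simp add: orthonormal_basis_def n_def)
  have T0: "(\<Sum>i<n. T (e i) (e i)) = 0"
    unfolding T_def using S
    by (subst sum.swap) (simp add: sym2_0_def tr2_def flip: sum_distrib_left n_def)
  \<comment> \<open>The total multiple of the metric removed by the projections.\<close>
  define K where "K = (\<Sum>\<alpha>\<in>A. c \<alpha> * (tr2 e (R_bar R e (S \<alpha>)) / real n))"
  have bar: "(\<Sum>\<alpha>\<in>A. c \<alpha> * R_bar R e (S \<alpha>) x y) = R_bar R e T x y" for x y
  proof -
    have "(\<Sum>\<alpha>\<in>A. c \<alpha> * R_bar R e (S \<alpha>) x y) =
        (\<Sum>\<alpha>\<in>A. \<Sum>k<n. \<Sum>l<n. R x (e k) (e l) y * (c \<alpha> * S \<alpha> (e k) (e l)))"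
      by (simp add: R_bar_def sum_distrib_left mult_ac flip: n_def)
    also have "\<dots> = (\<Sum>k<n. \<Sum>l<n. \<Sum>\<alpha>\<in>A. R x (e k) (e l) y * (c \<alpha> * S \<alpha> (e k) (e l)))"
      by (simp only: sum.swap[where A=A and B="{..<n}"])
    finally show ?thesis
      by (simp add: R_bar_def T_def sum_distrib_left flip: n_def)
  qed
  have "(\<Sum>\<alpha>\<in>A. c \<alpha> * R_second R e (S \<alpha>) x y) = R_bar R e T x y - K * (x \<bullet> y)" for x y
    unfolding bar[symmetric]
    by (simp add: R_second_def pr0_def K_def right_diff_distrib sum_subtractf sum_distrib_right
        mult.assoc flip: n_def)
  then have "inner2 e (\<lambda>x y. \<Sum>\<alpha>\<in>A. c \<alpha> * R_second R e (S \<alpha>) x y) T =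
      inner2 e (R_bar R e T) T - (\<Sum>i<n. \<Sum>j<n. K * (e i \<bullet> e j) * T (e i) (e j))"
    by (simp add: inner2_def left_diff_distrib sum_subtractf flip: n_def)
  also have "(\<Sum>i<n. \<Sum>j<n. K * (e i \<bullet> e j) * T (e i) (e j)) =
      (\<Sum>i<n. \<Sum>j<n. if i = j then K * T (e i) (e j) else 0)"
    by (intro sum.cong refl) (simp add: on)
  also have "\<dots> = K * (\<Sum>i<n. T (e i) (e i))"
    by (simp add: sum_distrib_left)
  finally show ?thesis
    by (simp add: T0 inner2_def R_bar_def sum_distrib_right flip: n_def)
qed

text \<open>Overwriting slot \<open>m\<close> is a bijection between the multi-indices with
  \<open>l\<close> there and those with \<open>k\<close> there. It serves to turn a component with a
  substituted entry into a plain component.\<close>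

lemma sum_multi_indices_move:
  fixes f :: "nat list \<Rightarrow> 'b::comm_monoid_add"
  assumes "m < p" "k < n" "l < n"
  shows "(\<Sum>I\<in>multi_indices n p. if I ! m = k then f I else 0) =
    (\<Sum>I\<in>multi_indices n p. if I ! m = l then f (I[m := k]) else 0)"
proof -
  have M: "I[m := a] \<in> multi_indices n p" if "I \<in> multi_indices n p" "a < n" for I a
    using that set_update_subset_insert[of I m a] by (auto simp: multi_indices_def)
  have "(\<Sum>I\<in>multi_indices n p. if I ! m = k then f I else 0) =
      (\<Sum>I | I \<in> multi_indices n p \<and> I ! m = k. f I)"
    by (simp add: sum.inter_filter)
  also have "\<dots> = (\<Sum>I | I \<in> multi_indices n p \<and> I ! m = l. f (I[m := k]))"
    by (rule sum.reindex_bij_witness[where i="\<lambda>I. I[m := k]" and j="\<lambda>I. I[m := l]"])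
      (use assms M in \<open>auto simp: multi_indices_def\<close>)
  finally show ?thesis
    by (simp add: sum.inter_filter)
qed

section \<open>Matrix units acting on forms\<close>

lemma nth_multi_indices_less: "I \<in> multi_indices n p \<Longrightarrow> m < p \<Longrightarrow> I ! m < n"
  using nth_mem[of m I] by (auto simp: multi_indices_def simp del: nth_mem)

text \<open>
  The components of \<open>\<omega>\<close> after the action of the matrix unit that sends \<open>e k\<close> to \<open>e l\<close> on
  one argument at a time, summed over the arguments.
\<close>

definition unit_act ::
    "(nat \<Rightarrow> 'a::euclidean_space) \<Rightarrow> ('a list \<Rightarrow> real) \<Rightarrow> nat list \<Rightarrow> nat \<Rightarrow> nat \<Rightarrow> real" where
  "unit_act e \<omega> I k l = (\<Sum>m<length I. if I ! m = k then \<omega> (map e (I[m := l])) else 0)"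

text \<open>All \<open>p\<close> slots contribute equally: moving a slot to the front changes the
  sign of both factors, hence not their product.\<close>

lemma sum_unit_act_mult:
  assumes w: "p_form p \<omega>" and "k < n" "l < n"
  shows "(\<Sum>I\<in>multi_indices n p. unit_act e \<omega> I k l * \<omega> (map e I)) =
    real p * (\<Sum>J\<in>multi_indices n (p - 1). \<omega> (e l # map e J) * \<omega> (e k # map e J))"
proof -
  define M where "M = multi_indices n"
  have "(\<Sum>I\<in>M p. unit_act e \<omega> I k l * \<omega> (map e I)) =
      (\<Sum>I\<in>M p. \<Sum>m<p. (if I ! m = k then 1 else 0) * \<omega> (map e (I[m := l])) * \<omega> (map e I))"
    by (intro sum.cong refl)
      (auto simp: unit_act_def sum_distrib_right M_def multi_indices_def intro!: sum.cong)
  also have "\<dots> =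
      (\<Sum>m<p. \<Sum>I\<in>M p. (if I ! m = k then 1 else 0) * \<omega> (map e (I[m := l])) * \<omega> (map e I))"
    by (rule sum.swap)
  also have "\<dots> = (\<Sum>m<p. \<Sum>i<n. \<Sum>J\<in>M (p - 1).
      (if i = k then 1 else 0) * \<omega> (map e (l # J)) * \<omega> (map e (i # J)))"
    unfolding M_def
    by (intro sum.cong refl sum_single_first[OF w, where c="\<lambda>i. if i = k then 1 else 0"]) simp
  also have "\<dots> = (\<Sum>m<p. \<Sum>i<n. if i = k then
      (\<Sum>J\<in>M (p - 1). \<omega> (map e (l # J)) * \<omega> (map e (i # J))) else 0)"
    by (intro sum.cong refl) auto
  finally show ?thesis
    using assms by (simp add: M_def)
qed

text \<open>
  The terms where both matrix units hit the same argument give the first summand, all other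
  ones the second.
\<close>

lemma sum_unit_act_unit_act:
  assumes w: "p_form p \<omega>" and lt: "k < n" "l < n" "i < n" "j < n"
  shows "(\<Sum>I\<in>multi_indices n p. unit_act e \<omega> I k l * unit_act e \<omega> I i j) =
    (if k = i then real p * (\<Sum>J\<in>multi_indices n (p - 1). \<omega> (e l # map e J) * \<omega> (e j # map e J))
      else 0)
    + real p * (real p - 1) *
      (\<Sum>J\<in>multi_indices n (p - 2). \<omega> (e k # e j # map e J) * \<omega> (e l # e i # map e J))"
proof -
  define M where "M = multi_indices n"
  define P where "P = (if k = i then \<Sum>J\<in>M (p - 1). \<omega> (e l # map e J) * \<omega> (e j # map e J) else 0)"
  define Q where "Q = (\<Sum>J\<in>M (p - 2). \<omega> (e k # e j # map e J) * \<omega> (e l # e i # map e J))"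
  \<comment> \<open>The contribution of replacing \<open>k\<close> by \<open>l\<close> in slot
    \<open>m\<close> of one factor and \<open>i\<close> by \<open>j\<close> in slot
    \<open>m'\<close> of the other.\<close>
  define X where "X I m m' = (if I ! m = k then
      (if I ! m' = i then \<omega> (map e (I[m := l])) * \<omega> (map e (I[m' := j])) else 0) else 0)" for I m m'
  have diag: "(\<Sum>I\<in>M p. X I m m) = P" if m: "m < p" for m
  proof (cases "k = i")
    case True
    have "(\<Sum>I\<in>M p. X I m m) =
        (\<Sum>I\<in>M p. if I ! m = k then \<omega> (map e (I[m := l])) * \<omega> (map e (I[m := j])) else 0)"
      using True by (intro sum.cong) (auto simp: X_def)
    \<comment> \<open>Renaming the entry in slot \<open>m\<close> from \<open>k\<close> to
      \<open>l\<close> turns the first factor into the component at \<open>I\<close> itself, the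
      shape needed for moving the slot to the front.\<close>
    also have "\<dots> = (\<Sum>I\<in>M p. if I ! m = l then
        \<omega> (map e (I[m := k, m := l])) * \<omega> (map e (I[m := k, m := j])) else 0)"
      unfolding M_def by (rule sum_multi_indices_move) (use m lt in auto)
    also have "\<dots> = (\<Sum>I\<in>M p. (if I ! m = l then 1 else 0) * \<omega> (map e (I[m := j])) * \<omega> (map e I))"
    proof (intro sum.cong refl)
      fix I
      show "(if I ! m = l then \<omega> (map e (I[m := k, m := l])) * \<omega> (map e (I[m := k, m := j])) else 0) =
          (if I ! m = l then 1 else 0) * \<omega> (map e (I[m := j])) * \<omega> (map e I)"
        using list_update_id[of I m] by auto
    qed
    also have "\<dots> = (\<Sum>a<n. \<Sum>J\<in>M (p - 1).
        (if a = l then 1 else 0) * \<omega> (map e (j # J)) * \<omega> (map e (a # J)))"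
      unfolding M_def by (rule sum_single_first[OF w m, where c="\<lambda>a. if a = l then 1 else 0"])
    also have "\<dots> = (\<Sum>a<n. if a = l then \<Sum>J\<in>M (p - 1). \<omega> (e j # map e J) * \<omega> (e a # map e J) else 0)"
      by (intro sum.cong) auto
    finally show ?thesis
      using lt True by (simp add: P_def mult.commute)
  next
    case False
    then have "X I m m = 0" for I by (simp add: X_def)
    then show ?thesis using False by (simp add: P_def)
  qed
  have offdiag: "(\<Sum>I\<in>M p. X I m m') = Q" if m: "m < p" "m' < p" "m \<noteq> m'" for m m'
  proof -
    \<comment> \<open>After the same renaming, the first factor is the component at
      \<open>I\<close>, and the second one carries both substitutions, \<open>k\<close> in slot
      \<open>m\<close> and \<open>j\<close> in slot \<open>m'\<close>.\<close>
    have "(\<Sum>I\<in>M p. X I m m') =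
        (\<Sum>I\<in>M p. if I ! m = l then
          (if I[m := k] ! m' = i then \<omega> (map e (I[m := k, m := l])) * \<omega> (map e (I[m := k, m' := j])) else 0)
          else 0)"
      unfolding M_def X_def by (rule sum_multi_indices_move) (use m lt in auto)
    also have "\<dots> = (\<Sum>I\<in>M p. (if I ! m = l \<and> I ! m' = i then 1 else 0) *
        \<omega> (map e (I[m := k, m' := j])) * \<omega> (map e I))"
    proof (intro sum.cong refl)
      fix I
      show "(if I ! m = l then
          (if I[m := k] ! m' = i then \<omega> (map e (I[m := k, m := l])) * \<omega> (map e (I[m := k, m' := j])) else 0)
          else 0) = (if I ! m = l \<and> I ! m' = i then 1 else 0) *
        \<omega> (map e (I[m := k, m' := j])) * \<omega> (map e I)"
        using list_update_id[of I m] m by auto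
    qed
    also have "\<dots> = (\<Sum>a<n. \<Sum>b<n. \<Sum>J\<in>M (p - 2). (if a = l \<and> b = i then 1 else 0) *
        \<omega> (map e (k # j # J)) * \<omega> (map e (a # b # J)))"
      unfolding M_def by (rule sum_pair_first[OF w m, where c="\<lambda>a b. if a = l \<and> b = i then 1 else 0"])
    also have "\<dots> = (\<Sum>a<n. \<Sum>b<n. if b = i then (if a = l then
        \<Sum>J\<in>M (p - 2). \<omega> (e k # e j # map e J) * \<omega> (e a # e b # map e J) else 0) else 0)"
      by (intro sum.cong) auto
    finally show ?thesis
      using lt by (simp add: Q_def)
  qed
  have "(\<Sum>I\<in>M p. unit_act e \<omega> I k l * unit_act e \<omega> I i j) = (\<Sum>I\<in>M p. \<Sum>m<p. \<Sum>m'<p. X I m m')"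
    by (intro sum.cong refl)
      (auto simp: unit_act_def sum_product X_def M_def multi_indices_def intro!: sum.cong)
  also have "\<dots> = (\<Sum>m<p. \<Sum>m'<p. \<Sum>I\<in>M p. X I m m')"
    by (simp only: sum.swap[where A="M p" and B="{..<p}"])
  \<comment> \<open>There are \<open>p\<close> pairs of equal slots and \<open>p * (p - 1)\<close>
    ordered pairs of distinct ones.\<close>
  also have "\<dots> = (\<Sum>m<p. \<Sum>m'<p. (if m' = m then P - Q else 0) + Q)"
    by (intro sum.cong refl) (simp add: diag offdiag)
  also have "\<dots> = real p * P + real p * (real p - 1) * Q"
    by (simp add: sum.distrib algebra_simps)
  finally show ?thesis
    by (simp add: P_def Q_def M_def)
qed

section \<open>Components of the form with values in trace-free symmetric tensors\<close>

lemma sym_act_components: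
  fixes e :: "nat \<Rightarrow> 'a::euclidean_space"
  assumes w: "p_form p \<omega>" and I: "I \<in> multi_indices DIM('a) p"
  shows "sym_act e h \<omega> (map e I) =
    (\<Sum>k<DIM('a). \<Sum>l<DIM('a). unit_act e \<omega> I k l * h (e k) (e l))"
proof -
  define n where "n = DIM('a)"
  have len: "length I = p" and lt: "m < p \<Longrightarrow> I ! m < n" for m
    using nth_multi_indices_less[OF I] I by (auto simp: multi_indices_def n_def)
  have "sym_act e h \<omega> (map e I) = (\<Sum>m<p. \<Sum>l<n. h (e (I ! m)) (e l) * \<omega> (map e (I[m := l])))"
    unfolding sym_act_def sharp2_def n_def[symmetric] using len
    by (intro sum.cong) (auto simp: p_form_update_sum[OF w] map_update)
  \<comment> \<open>Making the entry \<open>I ! m\<close> a summation index \<open>k\<close> with a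
    delta separates the components of \<open>h\<close> from those of the form.\<close>
  also have "\<dots> = (\<Sum>m<p. \<Sum>k<n. if k = I ! m then \<Sum>l<n. h (e k) (e l) * \<omega> (map e (I[m := l])) else 0)"
    by (rule sum.cong[OF refl]) (auto simp: lt)
  also have "\<dots> = (\<Sum>m<p. \<Sum>k<n. \<Sum>l<n.
      (if I ! m = k then \<omega> (map e (I[m := l])) else 0) * h (e k) (e l))"
    by (intro sum.cong) (auto simp: mult.commute)
  also have "\<dots> = (\<Sum>k<n. \<Sum>l<n. \<Sum>m<p.
      (if I ! m = k then \<omega> (map e (I[m := l])) else 0) * h (e k) (e l))"
    by (simp only: sum.swap[where A="{..<p}" and B="{..<n}"])
  finally show ?thesis
    by (simp add: unit_act_def sum_distrib_right len n_def)
qed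

text \<open>Replacing an entry by itself changes nothing, so every slot contributes the component at
  \<open>I\<close> once. This trace is the source of the coefficient \<open>p / n\<close> of the
  metric.\<close>

lemma sum_unit_act_diagonal:
  assumes "I \<in> multi_indices n p"
  shows "(\<Sum>k<n. unit_act e \<omega> I k k) = real p * \<omega> (map e I)"
proof -
  have len: "length I = p" and lt: "m < p \<Longrightarrow> I ! m < n" for m
    using nth_multi_indices_less[OF assms] assms by (auto simp: multi_indices_def)
  have "(\<Sum>k<n. unit_act e \<omega> I k k) =
      (\<Sum>m<p. \<Sum>k<n. if I ! m = k then \<omega> (map e (I[m := k])) else 0)"
    unfolding unit_act_def len by (rule sum.swap)
  also have "\<dots> = (\<Sum>m<p. \<omega> (map e I))"
    by (intro sum.cong) (auto simp: lt)
  finally show ?thesis by simp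
qed

text \<open>\<open>T I\<close> is the trace-free symmetric part of
  \<open>unit_act e \<omega> I\<close>, that is, the symmetric tensor at the multi-index
  \<open>I\<close> of the form acted on by the basis.\<close>

lemma inner_form_sym_unit_act:
  fixes R :: "'a::euclidean_space \<Rightarrow> 'a \<Rightarrow> 'a \<Rightarrow> 'a \<Rightarrow> real" and e :: "nat \<Rightarrow> 'a"
  defines "n \<equiv> DIM('a)"
  assumes w: "p_form p \<omega>" and e: "orthonormal_basis e" and S: "orthonormal_basis_sym2_0 e A S"
  defines "T \<equiv> \<lambda>I k l. (unit_act e \<omega> I k l + unit_act e \<omega> I l k) / 2 -
      (if k = l then real p * \<omega> (map e I) / real n else 0)"
  shows "inner_form_sym e p (R_form_sym R e A S \<omega>) (form_sym e A S \<omega>) =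
    (\<Sum>I\<in>multi_indices n p. \<Sum>i<n. \<Sum>j<n. \<Sum>k<n. \<Sum>l<n.
      R (e i) (e k) (e l) (e j) * T I k l * T I i j)"
proof -
  have S0: "\<And>\<alpha>. \<alpha> \<in> A \<Longrightarrow> S \<alpha> \<in> sym2_0 e"
    using S by (simp add: orthonormal_basis_sym2_0_def)
  have T: "(\<Sum>\<alpha>\<in>A. sym_act e (S \<alpha>) \<omega> (map e I) * S \<alpha> (e k) (e l)) = T I k l"
    if "I \<in> multi_indices n p" "k < n" "l < n" for I k l
    using that sum_orthonormal_basis_sym2_0[OF e S, of k l "unit_act e \<omega> I"]
    by (simp add: sym_act_components[OF w] sum_unit_act_diagonal T_def flip: n_def)
  show ?thesis
    unfolding inner_form_sym_def R_form_sym_def form_sym_def n_def[symmetric]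
    by (intro sum.cong refl, subst inner2_R_second_sum[OF e S0], assumption)
      (auto simp: T simp flip: n_def intro!: sum.cong)
qed

section \<open>Reordering fourfold sums\<close>

lemma sum_swap_pairs:
  fixes f :: "'i \<Rightarrow> 'j \<Rightarrow> 'k \<Rightarrow> 'l \<Rightarrow> 'b::comm_monoid_add"
  shows "(\<Sum>i\<in>A. \<Sum>j\<in>B. \<Sum>k\<in>C. \<Sum>l\<in>D. f i j k l) = (\<Sum>k\<in>C. \<Sum>l\<in>D. \<Sum>i\<in>A. \<Sum>j\<in>B. f i j k l)"
  by (simp only: sum.swap[where A=A and B=C] sum.swap[where A=A and B=D]
      sum.swap[where A=B and B=C] sum.swap[where A=B and B=D])

lemma sum_swap_inner_pairs:
  fixes f :: "'i \<Rightarrow> 'j \<Rightarrow> 'k \<Rightarrow> 'l \<Rightarrow> 'b::comm_monoid_add"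
  shows "(\<Sum>i\<in>A. \<Sum>j\<in>B. \<Sum>k\<in>C. \<Sum>l\<in>D. f i j k l) = (\<Sum>j\<in>B. \<Sum>i\<in>A. \<Sum>l\<in>D. \<Sum>k\<in>C. f i j k l)"
  by (subst sum.swap) (intro sum.cong refl sum.swap)

section \<open>Contractions of curvature components\<close>

text \<open>Only the components in a fixed basis are kept, so that contractions become identities
  between index sums. The symmetries hold for all natural indices because the tensor has them on
  arbitrary vectors.\<close>

locale curvature_components =
  fixes n :: nat and r :: "nat \<Rightarrow> nat \<Rightarrow> nat \<Rightarrow> nat \<Rightarrow> real"
  assumes swap12: "r j i k l = - r i j k l"
    and swap34: "r i j l k = - r i j k l"
    and pair_swap: "r k l i j = r i j k l"
    and bianchi: "r i j k l + r j k i l + r k i j l = 0"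
begin

definition ric :: "nat \<Rightarrow> nat \<Rightarrow> real" where
  "ric i j = (\<Sum>k<n. r i k j k)"

lemma ric_commute: "ric i j = ric j i"
  unfolding ric_def by (intro sum.cong refl pair_swap)

text \<open>
  The quadratic form of $\overline{R}$, evaluated on the symmetric part of \<open>u\<close> shifted by a
  multiple of the metric.
\<close>

lemma double_sum_sub_delta:
  fixes u :: "nat \<Rightarrow> nat \<Rightarrow> real" and c :: real
  defines "T \<equiv> \<lambda>k l. (u k l + u l k) / 2 - (if k = l then c else 0)"
  shows "(\<Sum>i<n. \<Sum>j<n. \<Sum>k<n. \<Sum>l<n. r i k l j * T k l * T i j) =
    (\<Sum>i<n. \<Sum>j<n. \<Sum>k<n. \<Sum>l<n. r i k l j * (u k l * u i j + u k l * u j i)) / 2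
    + 2 * c * (\<Sum>k<n. \<Sum>l<n. ric k l * u k l) - c\<^sup>2 * (\<Sum>k<n. ric k k)"
proof -
  \<comment> \<open>\<open>b\<close> is the bilinear form of the curvature contraction,
    \<open>d\<close> the metric and \<open>ut\<close> the transpose of \<open>u\<close>; the claim
    is the expansion of \<open>b T T\<close> with \<open>T\<close> equal to
    \<open>(u + ut) / 2 - c * d\<close>.\<close>
  define b where
    "b h h' = (\<Sum>i<n. \<Sum>j<n. \<Sum>k<n. \<Sum>l<n. r i k l j * h k l * h' i j)" for h h'
  define d where "d k l = (if k = l then 1 else 0 :: real)" for k l :: nat
  define ut where "ut k l = u l k" for k l
  have b_lin1: "b (\<lambda>k l. x * h k l + y * h1 k l + z * h2 k l) h' = x * b h h' + y * b h1 h' + z * b h2 h'"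
    for x y z h h1 h2 h'
    by (simp add: b_def algebra_simps sum.distrib sum_distrib_left)
  have b_commute: "b h h' = b h' h" for h h'
    unfolding b_def
    by (subst sum_swap_pairs, intro sum.cong refl) (metis swap12 swap34 pair_swap mult.assoc mult.commute)
  have b_trans: "b ut ut = b u u"
    unfolding b_def ut_def
    by (subst sum_swap_inner_pairs, intro sum.cong refl) (metis swap12 swap34 pair_swap minus_minus)
  \<comment> \<open>The metric contracts the first index with the last, whereas Ricci contracts
    second with fourth; the one transposition gives the minus sign.\<close>
  have b_d: "b h d = - (\<Sum>k<n. \<Sum>l<n. ric k l * h k l)" for h
  proof -
    have "b h d = (\<Sum>i<n. \<Sum>j<n. if i = j then \<Sum>k<n. \<Sum>l<n. r i k l j * h k l else 0)"
      unfolding b_def d_def by (intro sum.cong) auto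
    also have "\<dots> = (\<Sum>i<n. \<Sum>k<n. \<Sum>l<n. r i k l i * h k l)"
      by simp
    also have "\<dots> = (\<Sum>k<n. \<Sum>i<n. \<Sum>l<n. r i k l i * h k l)"
      by (rule sum.swap)
    also have "\<dots> = (\<Sum>k<n. \<Sum>l<n. \<Sum>i<n. r i k l i * h k l)"
      by (rule sum.cong[OF refl], rule sum.swap)
    also have "\<dots> = (\<Sum>k<n. \<Sum>l<n. - (ric k l * h k l))"
    proof (intro sum.cong refl)
      fix k l
      have "r i k l i = - r k i l i" for i by (rule swap12)
      then show "(\<Sum>i<n. r i k l i * h k l) = - (ric k l * h k l)"
        by (simp add: ric_def sum_negf flip: sum_distrib_right)
    qed
    finally show ?thesis by (simp add: sum_negf)
  qed
  have b_d_ut: "b ut d = b u d"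
    unfolding b_d ut_def by (subst sum.swap) (simp add: ric_commute)
  have b_d_d: "b d d = - (\<Sum>k<n. ric k k)"
  proof -
    have "b d d = - (\<Sum>k<n. \<Sum>l<n. if l = k then ric k l else 0)"
      unfolding b_d d_def by (intro arg_cong[where f=uminus] sum.cong) auto
    then show ?thesis by simp
  qed
  have b_T: "b T h = b u h / 2 + b ut h / 2 - c * b d h" for h
  proof -
    have "T = (\<lambda>k l. 1/2 * u k l + 1/2 * ut k l + (- c) * d k l)"
      by (auto simp: T_def ut_def d_def field_simps intro!: ext)
    then have "b T h = 1/2 * b u h + 1/2 * b ut h + (- c) * b d h"
      by (simp only: b_lin1)
    then show ?thesis by simp
  qed
  have "b T T = b u T / 2 + b ut T / 2 - c * b d T"
    by (rule b_T)
  also have "b u T = b u u / 2 + b u ut / 2 - c * b u d"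
    unfolding b_commute[of u T] b_T by (simp add: b_commute[of ut u] b_commute[of d u])
  also have "b ut T = b u ut / 2 + b u u / 2 - c * b u d"
    unfolding b_commute[of ut T] b_T by (simp add: b_commute[of d ut] b_trans b_d_ut)
  also have "b d T = b u d - c * b d d"
    unfolding b_commute[of d T] b_T by (simp add: b_d_ut)
  finally have "b T T = (b u u + b u ut) / 2 - 2 * c * b u d + c\<^sup>2 * b d d"
    by (simp add: field_simps power2_eq_square)
  moreover have "b u u + b u ut =
      (\<Sum>i<n. \<Sum>j<n. \<Sum>k<n. \<Sum>l<n. r i k l j * (u k l * u i j + u k l * u j i))"
    by (simp add: b_def ut_def algebra_simps flip: sum.distrib)
  ultimately show ?thesis
    unfolding b_d_d by (simp add: b_d b_def[of T T])
qed

text \<open>Since \<open>W\<close> is antisymmetric in its first two indices, only the corresponding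
  antisymmetric part of \<open>r\<close> contributes, and by the first Bianchi identity that part is
  minus one half of a curvature component.\<close>

lemma sum_bianchi:
  fixes W :: "nat \<Rightarrow> nat \<Rightarrow> nat \<Rightarrow> nat \<Rightarrow> real"
  assumes "\<And>a b c d. W b a c d = - W a b c d"
  shows "(\<Sum>i<n. \<Sum>j<n. \<Sum>k<n. \<Sum>l<n. r i k l j * W k j l i) =
    - (\<Sum>i<n. \<Sum>j<n. \<Sum>k<n. \<Sum>l<n. r i j k l * W i j k l) / 2"
proof -
  \<comment> \<open>The left side after renaming \<open>k\<close>, \<open>j\<close>,
    \<open>l\<close>, \<open>i\<close> to \<open>a\<close>, \<open>b\<close>, \<open>c\<close>,
    \<open>d\<close>.\<close>
  define Y where "Y = (\<Sum>a<n. \<Sum>b<n. \<Sum>c<n. \<Sum>d<n. r d a c b * W a b c d)"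
  have "(\<Sum>i<n. \<Sum>j<n. \<Sum>k<n. \<Sum>l<n. r i k l j * W k j l i) =
      (\<Sum>k<n. \<Sum>l<n. \<Sum>i<n. \<Sum>j<n. r i k l j * W k j l i)"
    by (rule sum_swap_pairs)
  also have "\<dots> = (\<Sum>k<n. \<Sum>l<n. \<Sum>j<n. \<Sum>i<n. r i k l j * W k j l i)"
    by (rule sum.cong[OF refl], rule sum.cong[OF refl], rule sum.swap)
  also have "\<dots> = Y"
    unfolding Y_def by (rule sum.cong[OF refl], rule sum.swap)
  finally have eq: "(\<Sum>i<n. \<Sum>j<n. \<Sum>k<n. \<Sum>l<n. r i k l j * W k j l i) = Y" .
  have "Y = (\<Sum>b<n. \<Sum>a<n. \<Sum>c<n. \<Sum>d<n. r d a c b * W a b c d)"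
    unfolding Y_def by (rule sum.swap)
  also have "\<dots> = (\<Sum>a<n. \<Sum>b<n. \<Sum>c<n. \<Sum>d<n. - (r d b c a * W a b c d))"
    by (intro sum.cong refl) (metis assms mult_minus_right)
  finally have "2 * Y =
      (\<Sum>a<n. \<Sum>b<n. \<Sum>c<n. \<Sum>d<n. r d a c b * W a b c d + - (r d b c a * W a b c d))"
    unfolding sum.distrib by (simp add: Y_def)
  also have "\<dots> = (\<Sum>a<n. \<Sum>b<n. \<Sum>c<n. \<Sum>d<n. - (r a b c d * W a b c d))"
  proof (intro sum.cong refl)
    fix a b c d
    \<comment> \<open>The two terms on the left equal \<open>r b c a d\<close> and
      \<open>- r c a b d\<close>, so this is the cyclic identity for \<open>a\<close>,
      \<open>b\<close>, \<open>c\<close>.\<close>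
    have "r d a c b - r d b c a = - r a b c d"
      using bianchi[of a b c d] swap12[of d a c b] pair_swap[of a d c b] swap12[of c b a d]
        pair_swap[of d b c a] swap34[of c a b d] by linarith
    then show "r d a c b * W a b c d + - (r d b c a * W a b c d) = - (r a b c d * W a b c d)"
      by (metis left_diff_distrib mult_minus_left uminus_add_conv_diff add.commute)
  qed
  finally show ?thesis
    by (simp add: eq sum_negf)
qed

text \<open>The first contraction contributes \<open>- 1 / 2\<close> through the Bianchi identity;
  the second one is the full contraction up to a transposition of the first two indices and
  contributes \<open>- 1\<close>.\<close>

lemma sum_antisymmetric:
  fixes W :: "nat \<Rightarrow> nat \<Rightarrow> nat \<Rightarrow> nat \<Rightarrow> real"
  assumes "\<And>a b c d. W b a c d = - W a b c d"
  shows "(\<Sum>i<n. \<Sum>j<n. \<Sum>k<n. \<Sum>l<n. r i k l j * (W k j l i + W k i l j)) =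
    - (3 / 2) * (\<Sum>i<n. \<Sum>j<n. \<Sum>k<n. \<Sum>l<n. r i j k l * W i j k l)"
proof -
  have "(\<Sum>i<n. \<Sum>j<n. \<Sum>k<n. \<Sum>l<n. r i k l j * W k i l j) =
      (\<Sum>i<n. \<Sum>k<n. \<Sum>j<n. \<Sum>l<n. r i k l j * W k i l j)"
    by (rule sum.cong[OF refl], rule sum.swap)
  also have "\<dots> = (\<Sum>k<n. \<Sum>i<n. \<Sum>l<n. \<Sum>j<n. r i k l j * W k i l j)"
    by (rule sum_swap_inner_pairs)
  also have "\<dots> = (\<Sum>k<n. \<Sum>i<n. \<Sum>l<n. \<Sum>j<n. - (r k i l j * W k i l j))"
    by (intro sum.cong refl) (metis swap12 mult_minus_left)
  finally have "(\<Sum>i<n. \<Sum>j<n. \<Sum>k<n. \<Sum>l<n. r i k l j * W k i l j) =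
      - (\<Sum>k<n. \<Sum>i<n. \<Sum>l<n. \<Sum>j<n. r k i l j * W k i l j)"
    by (simp add: sum_negf)
  then show ?thesis
    using sum_bianchi[OF assms] by (simp add: distrib_left sum.distrib)
qed

text \<open>The delta of \<open>k\<close> and \<open>i\<close> meets a curvature component with
  equal first indices and vanishes; the delta of \<open>k\<close> and \<open>j\<close> contracts the
  second index with the fourth, which is Ricci.\<close>

lemma sum_delta:
  fixes W :: "nat \<Rightarrow> nat \<Rightarrow> real"
  shows "(\<Sum>i<n. \<Sum>j<n. \<Sum>k<n. \<Sum>l<n. r i k l j *
      ((if k = i then W l j else 0) + (if k = j then W l i else 0))) =
    (\<Sum>i<n. \<Sum>l<n. ric i l * W l i)"
proof -
  have r0: "r i i l j = 0" for i l j
    using swap12[of i i l j] by simp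
  have "(\<Sum>i<n. \<Sum>j<n. \<Sum>k<n. \<Sum>l<n. r i k l j *
        ((if k = i then W l j else 0) + (if k = j then W l i else 0))) =
      (\<Sum>i<n. \<Sum>j<n. \<Sum>k<n. if k = j then \<Sum>l<n. r i k l j * W l i else 0)"
  proof (intro sum.cong refl)
    fix i j k
    show "(\<Sum>l<n. r i k l j * ((if k = i then W l j else 0) + (if k = j then W l i else 0))) =
        (if k = j then \<Sum>l<n. r i k l j * W l i else 0)"
      by (cases "k = i"; cases "k = j") (simp_all add: r0)
  qed
  also have "\<dots> = (\<Sum>i<n. \<Sum>j<n. \<Sum>l<n. r i j l j * W l i)"
    by simp
  also have "\<dots> = (\<Sum>i<n. \<Sum>l<n. \<Sum>j<n. r i j l j * W l i)"
    by (rule sum.cong[OF refl], rule sum.swap)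
  finally show ?thesis
    by (simp add: ric_def sum_distrib_right)
qed

end

section \<open>The curvature term in the Bochner formula\<close>

text \<open>Both \<open>3 / 2\<close> times the Weitzenboeck term and the quadratic form of the
  curvature operator contain \<open>\<kappa>\<close> with coefficient
  \<open>- 3 / 4 * p * (p - 1)\<close>. It cancels, and only multiples of the Ricci contraction
  \<open>\<rho>\<close> and of the scalar curvature remain.\<close>

lemma bochner_curvature_identity:
  fixes R :: "'a::euclidean_space \<Rightarrow> 'a \<Rightarrow> 'a \<Rightarrow> 'a \<Rightarrow> real" and e :: "nat \<Rightarrow> 'a"
  defines "n \<equiv> DIM('a)"
  assumes R: "algebraic_curvature_tensor R" and p: "p \<ge> 1" and w: "p_form p \<omega>"
    and e: "orthonormal_basis e" and S: "orthonormal_basis_sym2_0 e A S"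
  shows "3 / 2 * inner_form e p (Ric_L R e \<omega>) \<omega> =
    inner_form_sym e p (R_form_sym R e A S \<omega>) (form_sym e A S \<omega>)
    + real p * (real n - 2 * real p) / real n *
        (\<Sum>j<n. \<Sum>k<n. \<Sum>J\<in>multi_indices n (p - 1).
           Ric R e (e j) (e k) * \<omega> (e j # map e J) * \<omega> (e k # map e J))
    + (real p)\<^sup>2 / (real n)\<^sup>2 * scal R e * inner_form e p \<omega> \<omega>"
proof -
  define r where "r i j k l = R (e i) (e j) (e k) (e l)" for i j k l
  define M where "M = multi_indices n"
  interpret curvature_components n r
    using R unfolding algebraic_curvature_tensor_def r_def by unfold_locales blast+
  have n: "n > 0" by (simp add: n_def)
  have Ric: "Ric R e (e i) (e j) = ric i j" for i j
    by (simp add: Ric_def ric_def r_def flip: n_def)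
  define W2 where "W2 a b = (\<Sum>J\<in>M (p - 1). \<omega> (e a # map e J) * \<omega> (e b # map e J))" for a b
  define W4 where "W4 a b c d =
    (\<Sum>J\<in>M (p - 2). \<omega> (e a # e b # map e J) * \<omega> (e c # e d # map e J))" for a b c d
  define \<rho> where "\<rho> = (\<Sum>j<n. \<Sum>k<n. ric j k * W2 k j)"
  define \<kappa> where "\<kappa> = (\<Sum>i<n. \<Sum>j<n. \<Sum>k<n. \<Sum>l<n. r i j k l * W4 i j k l)"
  define N where "N = (\<Sum>I\<in>M p. (\<omega> (map e I))\<^sup>2)"
  define u where "u = unit_act e \<omega>"
  define q where "q = real p * (real p - 1)"

  have \<rho>: "(\<Sum>j<n. \<Sum>k<n. \<Sum>J\<in>M (p - 1). Ric R e (e j) (e k) * \<omega> (e j # map e J) * \<omega> (e k # map e J)) = \<rho>"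
    by (simp add: \<rho>_def W2_def Ric sum_distrib_left mult_ac)
  have Ric_L: "inner_form e p (Ric_L R e \<omega>) \<omega> = real p * \<rho> - q / 2 * \<kappa>"
  proof -
    have "(\<Sum>J\<in>M (p - 1). \<Sum>i<n. \<Sum>j<n. Ric R e (e i) (e j) * \<omega> (e i # map e J) * \<omega> (e j # map e J)) = \<rho>"
      unfolding \<rho>[symmetric] by (simp only: sum.swap[where A="M (p - 1)" and B="{..<n}"])
    moreover have "(\<Sum>J\<in>M (p - 2). \<Sum>i<n. \<Sum>j<n. \<Sum>k<n. \<Sum>l<n.
        R (e i) (e j) (e k) (e l) * \<omega> (e i # e j # map e J) * \<omega> (e k # e l # map e J)) = \<kappa>"
      by (simp only: sum.swap[where A="M (p - 2)" and B="{..<n}"])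
        (simp add: \<kappa>_def W4_def r_def sum_distrib_left mult.assoc)
    ultimately show ?thesis
      using inner_form_Ric_L[OF R w p, of e, folded n_def M_def] by (simp add: q_def)
  qed

  have quadratic: "(\<Sum>I\<in>M p. \<Sum>i<n. \<Sum>j<n. \<Sum>k<n. \<Sum>l<n. r i k l j * (u I k l * u I i j + u I k l * u I j i)) =
      real p * \<rho> - 3 / 2 * q * \<kappa>"
  proof -
    have "(\<Sum>I\<in>M p. \<Sum>i<n. \<Sum>j<n. \<Sum>k<n. \<Sum>l<n. r i k l j * (u I k l * u I i j + u I k l * u I j i)) =
        (\<Sum>i<n. \<Sum>j<n. \<Sum>k<n. \<Sum>l<n. \<Sum>I\<in>M p. r i k l j * (u I k l * u I i j + u I k l * u I j i))"
      by (simp only: sum.swap[where A="M p" and B="{..<n}"])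
    also have "\<dots> = (\<Sum>i<n. \<Sum>j<n. \<Sum>k<n. \<Sum>l<n.
        real p * (r i k l j * ((if k = i then W2 l j else 0) + (if k = j then W2 l i else 0)))
        + q * (r i k l j * (W4 k j l i + W4 k i l j)))"
    proof (intro sum.cong refl)
      fix i j k l assume "i \<in> {..<n}" "j \<in> {..<n}" "k \<in> {..<n}" "l \<in> {..<n}"
      then have lt: "i < n" "j < n" "k < n" "l < n" by auto
      have uu: "(\<Sum>I\<in>M p. u I k l * u I a b) = (if k = a then real p * W2 l b else 0) + q * W4 k b l a"
        if "a < n" "b < n" for a b
        using sum_unit_act_unit_act[OF w lt(3,4) that, of e] by (simp add: u_def M_def W2_def W4_def q_def)
      have "(\<Sum>I\<in>M p. r i k l j * (u I k l * u I i j + u I k l * u I j i)) =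
          r i k l j * ((\<Sum>I\<in>M p. u I k l * u I i j) + (\<Sum>I\<in>M p. u I k l * u I j i))"
        by (simp only: sum_distrib_left flip: sum.distrib)
      also have "\<dots> = r i k l j * (((if k = i then real p * W2 l j else 0) + q * W4 k j l i) +
          ((if k = j then real p * W2 l i else 0) + q * W4 k i l j))"
        by (simp only: uu[OF lt(1,2)] uu[OF lt(2,1)])
      finally show "(\<Sum>I\<in>M p. r i k l j * (u I k l * u I i j + u I k l * u I j i)) =
          real p * (r i k l j * ((if k = i then W2 l j else 0) + (if k = j then W2 l i else 0)))
          + q * (r i k l j * (W4 k j l i + W4 k i l j))"
        by (simp add: algebra_simps)
    qed
    also have "\<dots> = real p * \<rho> + q *
        (\<Sum>i<n. \<Sum>j<n. \<Sum>k<n. \<Sum>l<n. r i k l j * (W4 k j l i + W4 k i l j))"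
      using sum_delta[of W2] unfolding \<rho>_def by (simp only: sum.distrib flip: sum_distrib_left)
    also have "q * (\<Sum>i<n. \<Sum>j<n. \<Sum>k<n. \<Sum>l<n. r i k l j * (W4 k j l i + W4 k i l j)) =
        q * (- (3 / 2) * \<kappa>)"
    proof (cases "p \<ge> 2")
      case True
      have "W4 b a c d = - W4 a b c d" for a b c d
        unfolding W4_def sum_negf[symmetric]
      proof (intro sum.cong refl)
        fix J assume "J \<in> M (p - 2)"
        then have "\<omega> (e b # e a # map e J) = - \<omega> (e a # e b # map e J)"
          using p_form_swap[OF w, of "e a # e b # map e J" 0 1] True
          by (simp add: swap_list_def M_def multi_indices_def)
        then show "\<omega> (e b # e a # map e J) * \<omega> (e c # e d # map e J) =
            - (\<omega> (e a # e b # map e J) * \<omega> (e c # e d # map e J))"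
          by simp
      qed
      from sum_antisymmetric[of W4, OF this] show ?thesis
        by (simp add: \<kappa>_def)
    next
      case False
      then have "p = 1" using p by simp
      then show ?thesis by (simp add: q_def)
    qed
    finally show ?thesis by simp
  qed
  have linear: "(\<Sum>I\<in>M p. 2 * (real p * \<omega> (map e I) / real n) * (\<Sum>k<n. \<Sum>l<n. ric k l * u I k l)) =
      2 * (real p)\<^sup>2 / real n * \<rho>"
  proof -
    have "(\<Sum>I\<in>M p. 2 * (real p * \<omega> (map e I) / real n) * (\<Sum>k<n. \<Sum>l<n. ric k l * u I k l)) =
        2 * real p / real n * (\<Sum>I\<in>M p. \<Sum>k<n. \<Sum>l<n. ric k l * (u I k l * \<omega> (map e I)))"
      by (simp add: sum_distrib_left sum_divide_distrib mult_ac)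
    also have "(\<Sum>I\<in>M p. \<Sum>k<n. \<Sum>l<n. ric k l * (u I k l * \<omega> (map e I))) =
        (\<Sum>k<n. \<Sum>l<n. ric k l * (\<Sum>I\<in>M p. u I k l * \<omega> (map e I)))"
      by (simp only: sum.swap[where A="M p" and B="{..<n}"] sum_distrib_left)
    also have "\<dots> = (\<Sum>k<n. \<Sum>l<n. real p * (ric k l * W2 l k))"
      using sum_unit_act_mult[OF w, where n=n and e=e]
      by (intro sum.cong) (auto simp: u_def M_def W2_def)
    finally show ?thesis
      by (simp add: \<rho>_def power2_eq_square flip: sum_distrib_left)
  qed
  have scal: "(\<Sum>k<n. ric k k) = scal R e"
    by (simp add: scal_def Ric flip: n_def)
  have square: "(\<Sum>I\<in>M p. (real p * \<omega> (map e I) / real n)\<^sup>2 * scal R e) =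
      (real p)\<^sup>2 / (real n)\<^sup>2 * scal R e * N"
    by (simp add: N_def sum_distrib_left sum_divide_distrib power_mult_distrib power_divide mult_ac)
  \<comment> \<open>For each \<open>I\<close> the metric is subtracted with its own coefficient
    \<open>p * \<omega> (map e I) / n\<close>; summing over \<open>I\<close> then makes the cross
    term a Ricci contraction and the square a multiple of the norm.\<close>
  have "inner_form_sym e p (R_form_sym R e A S \<omega>) (form_sym e A S \<omega>) =
      (\<Sum>I\<in>M p. (\<Sum>i<n. \<Sum>j<n. \<Sum>k<n. \<Sum>l<n.
          r i k l j * (u I k l * u I i j + u I k l * u I j i)) / 2
        + 2 * (real p * \<omega> (map e I) / real n) * (\<Sum>k<n. \<Sum>l<n. ric k l * u I k l)
        - (real p * \<omega> (map e I) / real n)\<^sup>2 * scal R e)"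
    unfolding inner_form_sym_unit_act[OF w e S, of R, folded n_def r_def u_def M_def]
      double_sum_sub_delta scal ..
  also have "\<dots> = (real p * \<rho> - 3 / 2 * q * \<kappa>) / 2 + 2 * (real p)\<^sup>2 / real n * \<rho>
      - (real p)\<^sup>2 / (real n)\<^sup>2 * scal R e * N"
    by (simp only: sum.distrib sum_subtractf linear square quadratic flip: sum_divide_distrib)
  finally have G: "inner_form_sym e p (R_form_sym R e A S \<omega>) (form_sym e A S \<omega>) =
      (real p * \<rho> - 3 / 2 * q * \<kappa>) / 2 + 2 * (real p)\<^sup>2 / real n * \<rho>
      - (real p)\<^sup>2 / (real n)\<^sup>2 * scal R e * N" .
  have norm: "inner_form e p \<omega> \<omega> = N"
    by (simp add: inner_form_def N_def M_def power2_eq_square flip: n_def)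
  show ?thesis
    unfolding G norm \<rho>[unfolded M_def] Ric_L using n by (simp add: field_simps power2_eq_square)
qed

text \<open>Both sides compute the pairing of the form with its image under the diagonal matrix with
  entries \<open>c\<close>: by slots moved to the front, and by eigenvalues, since that matrix
  multiplies the component at \<open>I\<close> by the sum of \<open>c\<close> over the entries of
  \<open>I\<close>.\<close>

lemma sum_diagonal_first_index:
  assumes w: "p_form p \<omega>"
  shows "real p * (\<Sum>j<n. \<Sum>J\<in>multi_indices n (p - 1). c j * (\<omega> (e j # map e J))\<^sup>2) =
    (\<Sum>I\<in>multi_indices n p. (\<Sum>i\<leftarrow>I. c i) * (\<omega> (map e I))\<^sup>2)"
proof -
  define M where "M = multi_indices n"
  have "(\<Sum>k<n. c k * (\<Sum>I\<in>M p. unit_act e \<omega> I k k * \<omega> (map e I))) =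
      real p * (\<Sum>j<n. \<Sum>J\<in>M (p - 1). c j * (\<omega> (e j # map e J))\<^sup>2)"
    unfolding sum_distrib_left[of "real p"] M_def
    by (intro sum.cong refl)
      (subst sum_unit_act_mult[OF w], auto simp: sum_distrib_left power2_eq_square mult_ac)
  moreover have "(\<Sum>k<n. c k * (\<Sum>I\<in>M p. unit_act e \<omega> I k k * \<omega> (map e I))) =
      (\<Sum>I\<in>M p. (\<Sum>k<n. c k * unit_act e \<omega> I k k) * \<omega> (map e I))"
    by (simp only: sum_distrib_left sum_distrib_right sum.swap[where A="{..<n}" and B="M p"] mult.assoc)
  moreover have "(\<Sum>k<n. c k * unit_act e \<omega> I k k) = (\<Sum>i\<leftarrow>I. c i) * \<omega> (map e I)"
    if I: "I \<in> M p" for I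
  proof -
    have len: "length I = p" and lt: "m < p \<Longrightarrow> I ! m < n" for m
      using nth_multi_indices_less[of I n p m] I by (auto simp: M_def multi_indices_def)
    have "(\<Sum>k<n. c k * unit_act e \<omega> I k k) =
        (\<Sum>k<n. \<Sum>m<p. if I ! m = k then c k * \<omega> (map e (I[m := k])) else 0)"
      unfolding unit_act_def len sum_distrib_left by (intro sum.cong) auto
    also have "\<dots> = (\<Sum>m<p. \<Sum>k<n. if I ! m = k then c k * \<omega> (map e (I[m := k])) else 0)"
      by (rule sum.swap)
    also have "\<dots> = (\<Sum>m<p. c (I ! m) * \<omega> (map e I))"
      by (intro sum.cong) (auto simp: lt)
    finally show ?thesis
      by (simp add: sum_list_sum_nth len sum_distrib_right flip: atLeast0LessThan)
  qed
  ultimately show ?thesis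
    by (simp add: M_def power2_eq_square mult.assoc)
qed

section \<open>The general, the Ricci-diagonal and the Einstein form\<close>

theorem proposition2p1:
  fixes R :: "'a::euclidean_space \<Rightarrow> 'a \<Rightarrow> 'a \<Rightarrow> 'a \<Rightarrow> real"
    and e :: "nat \<Rightarrow> 'a"
    and S :: "'i \<Rightarrow> 'a \<Rightarrow> 'a \<Rightarrow> real" and A :: "'i set"
    and \<omega> :: "'a list \<Rightarrow> real"
    and n p :: nat
  assumes "DIM('a) = n"
    and "algebraic_curvature_tensor R"
    and "p \<ge> 1" and "p_form p \<omega>"
    and "orthonormal_basis e"
    and "orthonormal_basis_sym2_0 e A S"
  shows
    "(3 / 2 * inner_form e p (Ric_L R e \<omega>) \<omega> =
       inner_form_sym e p (R_form_sym R e A S \<omega>) (form_sym e A S \<omega>)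
       + real p * (real n - 2 * real p) / real n *
           (\<Sum>j<n. \<Sum>k<n. \<Sum>J\<in>multi_indices n (p - 1).
              Ric R e (e j) (e k) * \<omega> (e j # map e J) * \<omega> (e k # map e J))
       + (real p)\<^sup>2 / (real n)\<^sup>2 * scal R e * inner_form e p \<omega> \<omega>)
     \<and>
     ((\<forall>i<n. \<forall>j<n. i \<noteq> j \<longrightarrow> Ric R e (e i) (e j) = 0) \<longrightarrow>
     3 / 2 * inner_form e p (Ric_L R e \<omega>) \<omega> =
       inner_form_sym e p (R_form_sym R e A S \<omega>) (form_sym e A S \<omega>)
       + (real n - 2 * real p) / real n *
           (\<Sum>I\<in>multi_indices n p. (\<Sum>i\<leftarrow>I. Ric R e (e i) (e i)) * (\<omega> (map e I))\<^sup>2)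
       + (real p)\<^sup>2 / (real n)\<^sup>2 * scal R e * inner_form e p \<omega> \<omega>)
     \<and>
     ((\<forall>x y. Ric R e x y = scal R e / real n * (x \<bullet> y)) \<longrightarrow>
     3 / 2 * inner_form e p (Ric_L R e \<omega>) \<omega> =
       inner_form_sym e p (R_form_sym R e A S \<omega>) (form_sym e A S \<omega>)
       + real p * (real n - real p) / (real n)\<^sup>2 * scal R e * inner_form e p \<omega> \<omega>)"
proof -
  note n = assms(1)
  have n0: "n > 0" using n by (metis DIM_positive)
  define G where "G = inner_form_sym e p (R_form_sym R e A S \<omega>) (form_sym e A S \<omega>)"
  define L where "L = 3 / 2 * inner_form e p (Ric_L R e \<omega>) \<omega>"
  define N where "N = inner_form e p \<omega> \<omega>"
  define P where "P = (\<Sum>j<n. \<Sum>k<n. \<Sum>J\<in>multi_indices n (p - 1).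
      Ric R e (e j) (e k) * \<omega> (e j # map e J) * \<omega> (e k # map e J))"
  define D where "D = (\<Sum>I\<in>multi_indices n p. (\<Sum>i\<leftarrow>I. Ric R e (e i) (e i)) * (\<omega> (map e I))\<^sup>2)"
  have general: "L = G + real p * (real n - 2 * real p) / real n * P + (real p)\<^sup>2 / (real n)\<^sup>2 * scal R e * N"
    using bochner_curvature_identity[OF assms(2-6)] unfolding n G_def L_def N_def P_def .
  have PD: "real p * P = D" if diag: "\<And>i j. i < n \<Longrightarrow> j < n \<Longrightarrow> i \<noteq> j \<Longrightarrow> Ric R e (e i) (e j) = 0"
  proof -
    have "P = (\<Sum>j<n. \<Sum>k<n. if k = j then \<Sum>J\<in>multi_indices n (p - 1).
        Ric R e (e j) (e j) * (\<omega> (e j # map e J))\<^sup>2 else 0)"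
      unfolding P_def by (intro sum.cong) (auto simp: diag power2_eq_square mult.assoc)
    then show ?thesis
      unfolding D_def sum_diagonal_first_index[OF assms(4), symmetric] by simp
  qed
  have diagonal: "L = G + (real n - 2 * real p) / real n * D + (real p)\<^sup>2 / (real n)\<^sup>2 * scal R e * N"
    if "\<forall>i<n. \<forall>j<n. i \<noteq> j \<longrightarrow> Ric R e (e i) (e j) = 0"
    unfolding general using that by (simp add: mult_ac flip: PD)
  \<comment> \<open>An Einstein tensor is diagonal in every orthonormal basis, and each of the
    \<open>p\<close> entries of \<open>I\<close> contributes \<open>scal R e / n\<close>; the
    coefficients \<open>p * (n - 2 * p)\<close> and \<open>p\<^sup>2\<close> over
    \<open>n\<^sup>2\<close> add up to \<open>p * (n - p)\<close>.\<close>
  have einstein: "L = G + real p * (real n - real p) / (real n)\<^sup>2 * scal R e * N"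
    if E: "\<forall>x y. Ric R e x y = scal R e / real n * (x \<bullet> y)"
  proof -
    have Ric: "Ric R e (e i) (e j) = (if i = j then scal R e / real n else 0)" if "i < n" "j < n" for i j
      using assms(5) that E by (simp add: orthonormal_basis_def n)
    have "D = (\<Sum>I\<in>multi_indices n p. real p * (scal R e / real n) * (\<omega> (map e I))\<^sup>2)"
      unfolding D_def
    proof (intro sum.cong refl)
      fix I assume I: "I \<in> multi_indices n p"
      then have "map (\<lambda>i. Ric R e (e i) (e i)) I = map (\<lambda>i. scal R e / real n) I"
        by (intro map_cong refl) (auto simp: multi_indices_def Ric)
      then show "(\<Sum>i\<leftarrow>I. Ric R e (e i) (e i)) * (\<omega> (map e I))\<^sup>2 =
          real p * (scal R e / real n) * (\<omega> (map e I))\<^sup>2"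
        using I by (simp only: sum_list_triv) (simp add: multi_indices_def)
    qed
    then have "D = real p * (scal R e / real n) * N"
      unfolding N_def inner_form_def sum_distrib_left by (simp add: n power2_eq_square)
    moreover have "L = G + (real n - 2 * real p) / real n * D + (real p)\<^sup>2 / (real n)\<^sup>2 * scal R e * N"
      by (rule diagonal) (simp add: Ric)
    ultimately have "L = G + (real n - 2 * real p) / real n * (real p * (scal R e / real n) * N)
        + (real p)\<^sup>2 / (real n)\<^sup>2 * scal R e * N"
      by simp
    then show ?thesis
      using n0 by (simp add: field_simps power2_eq_square)
  qed
  show ?thesis
    using general diagonal einstein unfolding G_def L_def N_def P_def D_def by blast
qed

end
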